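(* Let $X$ be a non-empty set, let $F\le\mathrm{Sym}(X)$, let $\{O_i\}_{i\in I}$ be the family of orbits of $F$ on $X$, and choose a representative $x_i\in O_i$ for each $i\in I$. Let $\mathcal G$ be the graph of group actions whose base graph has exactly one vertex $v$ and, for each $i\in I$, one self-reverse loop $a_i$; the action at $v$ is $(F,X)$; the action at $a_i$ is that of $H(a_i)=\{1\}$ on $Y(a_i)=\{x_i\}$, with inversion agent $h_{a_i}=1$; and $\Phi_{a_i}\colon Y(a_i)\to X$ sends $x_i$ to $x_i$. Then the Burger–Mozes group $U(F)$ is equal to the universal group $\mathcal U(\mathcal G)$, in the sense that the action of $\mathcal U(\mathcal G)$ on its associated tree is isomorphic, via an isomorphism of trees, to the action of $U(F)$ on the $|X|$-regular tree.
   Context: **Graphs.** A graph $\Gamma$ has a vertex set $V\Gamma$, an arc set $A\Gamma$, maps $o,t\colon A\Gamma\to V\Gamma$ (origin, terminus) and an involution $a\mapsto\bar a$ on arcs with $o(a)=t(\bar a)$; an arc with $\bar a=a$ is called self-reverse. Graph morphisms preserve $o$, $t$ and reversal. $\mathrm{Star}(v)=t^{-1}(v)$. A tree is a connected graph without loops and without two arcs having the same origin and the same terminus, which has no simple cycles of length $\ge 3$. Two actions $(G,T)$, $(G',T')$ are isomorphic via an isomorphism of trees if there are a group isomorphism $\varphi\colon G\to G'$ and a tree isomorphism $\Phi\colon T\to T'$ with $\varphi(g)\Phi=\Phi g$ for all $g\in G$. **Burger–Mozes group.** Let $T$ be the $|X|$-regular tree. A legal colouring of $T$ is a map $c\colon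 AT\to X$ with $c(\bar a)=c(a)$ for all $a\in AT$ and such that $c|_{\mathrm{Star}(v)}$ is a bijection onto $X$ for every vertex $v$. Fixing a legal colouring $c$, $U(F)$ is the group of all automorphisms $g$ of $T$ such that $c\,g\,(c|_{\mathrm{Star}(v)})^{-1}\in F$ for all vertices $v$ of $T$. **Graph of group actions (gga).** A permutation group action $(G,X)$ is a faithful action on a non-empty set; for $Y\subseteq X$, $G^Y$ is the permutation group induced on $Y$ by the setwise stabiliser of $Y$; an embedding $(H,Y)\hookrightarrow(G,X)$ is given by an injection $\Phi\colon Y\to X$ such that $h\mapsto\Phi h\Phi^{-1}$ is an isomorphism $H\to G^{\Phi(Y)}$. A gga $\mathcal G$ consists of: a connected graph $\Delta$ (base graph); for every $v\in V\Delta$ a permutation group action $(G(v),X(v))$; for every $a\in A\Delta$ a permutation group action $(H(a),Y(a))$ with $(H(\bar a),Y(\bar a))=(H(a),Y(a))$ and an embedding $\Phi_a\colon(H(a),Y(a))\hookrightarrow(G(t(a)),X(t(a)))$; and for every self-reverse arc $a$ a permutation $h_a$ of $Y(a)$ (inversion agent) with $h_aH(a)h_a^{-1}=H(a)$ and $h_a^2\in H(a)$. An $a$-adhesion map is a map $g\Phi_a$ with $g\in G(t(a))$; its image is an $a$-adhesion set. If $a$ is self-reverse, a twisted $a$-adhesion map is a map $g\Phi_ah_a$ with $g\in G(t(a))$. **Scaffolding.** A scaffolding $(\Sigma,\sim,\pi,p)$ for $\mathcal G$ is a graph $\Sigma$ with an equivalence relation $\sim$ on $V\Sigma$, extended to $A\Sigma$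 by $a\sim a'$ iff $o(a)\sim o(a')$ and $t(a)\sim t(a')$ (write $[x]$ for the class of $x$ as a set and $\llbracket x\rrbracket$ for the class as a vertex or arc of $T_\Sigma:=\Sigma/\!\sim$), such that: (i) $T_\Sigma$ is a tree; (ii) no arc of $\Sigma$ has both ends in the same class; (iii) $\pi\colon T_\Sigma\to\Delta$ is a graph morphism; (iv) $p$ is a map from $V\Sigma\cup A\Sigma$ to $\bigcup_v X(v)\cup\bigcup_a Y(a)$ such that: $p$ restricts to bijections $[v]\to X(\pi(\llbracket v\rrbracket))$ and $[a]\to Y(\pi(\llbracket a\rrbracket))$; $p(\bar b)=p(b)$ for every arc $b$; if $\Psi_{\llbracket a\rrbracket}$ is the unique map with $\Psi_{\llbracket a\rrbracket}(p(b))=p(t(b))$ for all $b\in[a]$, then $\Psi_{\llbracket a\rrbracket}$ is a $\pi(\llbracket a\rrbracket)$-adhesion map when $\pi(\llbracket a\rrbracket)$ is not self-reverse, while when $\pi(\llbracket a\rrbracket)$ is self-reverse one of $\Psi_{\llbracket a\rrbracket},\Psi_{\llbracket\bar a\rrbracket}$ is a $\pi(\llbracket a\rrbracket)$-adhesion map and the other is a twisted one; and for every vertex $\llbracket v\rrbracket$ of $T_\Sigma$, every $b\in A\Delta$ with $t(b)=\pi(\llbracket v\rrbracket)$ and every $b$-adhesion set $S$, there is exactly one arc $\llbracket a\rrbracket$ of $T_\Sigma$ with $t(\llbracket a\rrbracket)=\llbracket v\rrbracket$, $\pi(\llbracket a\rrbracket)=b$ and $\Psi_{\llbracket a\rrbracket}(Y(b))=S$.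 **Universal group of a gga.** Fix a scaffolding. $\mathcal U(\mathcal G)$ is the group of all graph automorphisms $g$ of $\Sigma$ which preserve $\sim$ and $\pi$ and are acceptable: for every $\llbracket v\rrbracket\in VT_\Sigma$ the permutation $g_{\llbracket v\rrbracket}$ of $X(\pi(\llbracket v\rrbracket))$ determined by $g_{\llbracket v\rrbracket}(p(x))=p(g(x))$, $x\in[v]$, lies in $G(\pi(\llbracket v\rrbracket))$. The associated tree is $T_{\mathcal G}=T_\Sigma$, on which $\mathcal U(\mathcal G)$ acts naturally. *)

theory Defs
  imports
    "Graph_Theory.Graph_Theory"
    "HOL-Algebra.Bij"
    "HOL-Algebra.Group_Action"
    "HOL-Library.Equipollence"
begin

section \<open>Graphs with an arc reversal\<close>

text \<open>
  The origin of an arc is its tail and its terminus is its head. The theory of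
  bidirected digraphs in Graph\_Theory forbids self-reverse arcs, so the reversal is
  added here as a new field; predicates of Graph\_Theory apply to the underlying digraph.
\<close>

record ('v, 'a) pre_rgraph = "('v, 'a) pre_digraph" +
  arc_rev :: "'a \<Rightarrow> 'a"

abbreviation digraph_of :: "('v, 'a) pre_rgraph \<Rightarrow> ('v, 'a) pre_digraph" where
  "digraph_of G \<equiv> pre_digraph.truncate G"

abbreviation Star :: "('v, 'a) pre_rgraph \<Rightarrow> 'v \<Rightarrow> 'a set" where
  "Star G v \<equiv> in_arcs (digraph_of G) v"

locale rgraph =
  fixes G :: "('v, 'a) pre_rgraph"
  assumes wf: "wf_digraph (digraph_of G)"
    and rev_in_arcs: "a \<in> arcs G \<Longrightarrow> arc_rev G a \<in> arcs G"
    and rev_rev: "a \<in> arcs G \<Longrightarrow> arc_rev G (arc_rev G a) = a"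
    and tail_eq_head_rev: "a \<in> arcs G \<Longrightarrow> tail G a = head G (arc_rev G a)"

text \<open>
  The library predicate \<^const>\<open>tree\<close> concerns digraphs without any directed cycle, so it
  excludes an arc together with its reverse. Here only cycles of length at least 3
  are excluded.
\<close>

locale rtree = rgraph T for T :: "('v, 'a) pre_rgraph" +
  assumes connected: "connected (digraph_of T)"
    and loopfree: "loopfree_digraph (digraph_of T)"
    and nomulti: "nomulti_digraph (digraph_of T)"
    and no_cycle: "\<not> (\<exists>q. pre_digraph.cycle (digraph_of T) q \<and> 3 \<le> length q)"

definition rgraph_hom ::
    "('v, 'a) pre_rgraph \<Rightarrow> ('w, 'b) pre_rgraph \<Rightarrow> ('v \<Rightarrow> 'w) \<Rightarrow> ('a \<Rightarrow> 'b) \<Rightarrow> bool" where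
  "rgraph_hom G H fV fA \<longleftrightarrow>
     fV \<in> verts G \<rightarrow> verts H \<and> fA \<in> arcs G \<rightarrow> arcs H \<and>
     (\<forall>a\<in>arcs G. tail H (fA a) = fV (tail G a) \<and>
                 head H (fA a) = fV (head G a) \<and>
                 arc_rev H (fA a) = fA (arc_rev G a))"

definition rgraph_iso ::
    "('v, 'a) pre_rgraph \<Rightarrow> ('w, 'b) pre_rgraph \<Rightarrow> ('v \<Rightarrow> 'w) \<Rightarrow> ('a \<Rightarrow> 'b) \<Rightarrow> bool" where
  "rgraph_iso G H fV fA \<longleftrightarrow>
     rgraph_hom G H fV fA \<and>
     bij_betw fV (verts G) (verts H) \<and> bij_betw fA (arcs G) (arcs H)"

text \<open>Automorphisms are pairs of extensional permutations of the vertices and of the arcs.\<close>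

definition rgraph_auts :: "('v, 'a) pre_rgraph \<Rightarrow> (('v \<Rightarrow> 'v) \<times> ('a \<Rightarrow> 'a)) set" where
  "rgraph_auts G =
     {(gV, gA). gV \<in> Bij (verts G) \<and> gA \<in> Bij (arcs G) \<and> rgraph_hom G G gV gA}"

definition aut_group :: "('v, 'a) pre_rgraph \<Rightarrow> (('v \<Rightarrow> 'v) \<times> ('a \<Rightarrow> 'a)) monoid" where
  "aut_group G = (BijGroup (verts G) \<times>\<times> BijGroup (arcs G)) \<lparr>carrier := rgraph_auts G\<rparr>"

definition isomorphic_tree_actions ::
    "('g, 'm) monoid_scheme \<Rightarrow> ('v, 'a) pre_rgraph \<Rightarrow> ('g \<Rightarrow> ('v \<Rightarrow> 'v) \<times> ('a \<Rightarrow> 'a)) \<Rightarrow>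
     ('h, 'n) monoid_scheme \<Rightarrow> ('w, 'b) pre_rgraph \<Rightarrow> ('h \<Rightarrow> ('w \<Rightarrow> 'w) \<times> ('b \<Rightarrow> 'b)) \<Rightarrow> bool" where
  "isomorphic_tree_actions G T \<rho> G' T' \<rho>' \<longleftrightarrow>
     group_hom G (aut_group T) \<rho> \<and> group_hom G' (aut_group T') \<rho>' \<and>
     (\<exists>\<phi> \<Phi>V \<Phi>A. \<phi> \<in> iso G G' \<and> rgraph_iso T T' \<Phi>V \<Phi>A \<and>
        (\<forall>g\<in>carrier G.
           (\<forall>v\<in>verts T. fst (\<rho>' (\<phi> g)) (\<Phi>V v) = \<Phi>V (fst (\<rho> g) v)) \<and>
           (\<forall>a\<in>arcs T. snd (\<rho>' (\<phi> g)) (\<Phi>A a) = \<Phi>A (snd (\<rho> g) a))))"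


section \<open>Burger--Mozes groups\<close>

definition regular_tree :: "'x set \<Rightarrow> ('v, 'a) pre_rgraph \<Rightarrow> bool" where
  "regular_tree X T \<longleftrightarrow> rtree T \<and> (\<forall>v\<in>verts T. Star T v \<approx> X)"

definition legal_colouring :: "'x set \<Rightarrow> ('v, 'a) pre_rgraph \<Rightarrow> ('a \<Rightarrow> 'x) \<Rightarrow> bool" where
  "legal_colouring X T c \<longleftrightarrow>
     (\<forall>a\<in>arcs T. c (arc_rev T a) = c a) \<and> (\<forall>v\<in>verts T. bij_betw c (Star T v) X)"

definition burger_mozes_group ::
    "'x set \<Rightarrow> ('x \<Rightarrow> 'x) set \<Rightarrow> ('v, 'a) pre_rgraph \<Rightarrow> ('a \<Rightarrow> 'x) \<Rightarrow>
     (('v \<Rightarrow> 'v) \<times> ('a \<Rightarrow> 'a)) monoid" where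
  "burger_mozes_group X F T c =
     (aut_group T) \<lparr>carrier := {g \<in> rgraph_auts T.
        \<forall>v\<in>verts T. (\<lambda>z\<in>X. c (snd g (inv_into (Star T v) c z))) \<in> F}\<rparr>"


section \<open>Graphs of group actions\<close>

text \<open>
  The group of a permutation group action is identified with its (faithful) image in the
  symmetric group of the set acted on.
\<close>

definition perm_group_action :: "('x \<Rightarrow> 'x) set \<Rightarrow> 'x set \<Rightarrow> bool" where
  "perm_group_action G X \<longleftrightarrow> X \<noteq> {} \<and> subgroup G (BijGroup X)"

definition induced_perm_group :: "('x \<Rightarrow> 'x) set \<Rightarrow> 'x set \<Rightarrow> ('x \<Rightarrow> 'x) set" where
  "induced_perm_group G Y = {restrict g Y | g. g \<in> G \<and> g ` Y = Y}"

definition action_embedding ::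
    "('y \<Rightarrow> 'y) set \<Rightarrow> 'y set \<Rightarrow> ('x \<Rightarrow> 'x) set \<Rightarrow> 'x set \<Rightarrow> ('y \<Rightarrow> 'x) \<Rightarrow> bool" where
  "action_embedding H Y G X \<Phi> \<longleftrightarrow>
     \<Phi> \<in> Y \<rightarrow> X \<and> inj_on \<Phi> Y \<and>
     (\<lambda>h. \<lambda>z\<in>\<Phi> ` Y. \<Phi> (h (inv_into Y \<Phi> z)))
       \<in> iso ((BijGroup Y) \<lparr>carrier := H\<rparr>)
             ((BijGroup (\<Phi> ` Y)) \<lparr>carrier := induced_perm_group G (\<Phi> ` Y)\<rparr>)"

text \<open>The field \<open>agent\<close> is meaningful only on self-reverse arcs.\<close>

record ('v, 'a, 'x, 'y) pre_gga =
  base :: "('v, 'a) pre_rgraph"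
  vgroup :: "'v \<Rightarrow> ('x \<Rightarrow> 'x) set"
  vset :: "'v \<Rightarrow> 'x set"
  agroup :: "'a \<Rightarrow> ('y \<Rightarrow> 'y) set"
  aset :: "'a \<Rightarrow> 'y set"
  emb :: "'a \<Rightarrow> 'y \<Rightarrow> 'x"
  agent :: "'a \<Rightarrow> 'y \<Rightarrow> 'y"

locale gga =
  fixes \<G> :: "('v, 'a, 'x, 'y) pre_gga"
  assumes base_rgraph: "rgraph (base \<G>)"
    and base_connected: "connected (digraph_of (base \<G>))"
    and vertex_action: "v \<in> verts (base \<G>) \<Longrightarrow> perm_group_action (vgroup \<G> v) (vset \<G> v)"
    and arc_action: "a \<in> arcs (base \<G>) \<Longrightarrow> perm_group_action (agroup \<G> a) (aset \<G> a)"
    and agroup_rev: "a \<in> arcs (base \<G>) \<Longrightarrow> agroup \<G> (arc_rev (base \<G>) a) = agroup \<G> a"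
    and aset_rev: "a \<in> arcs (base \<G>) \<Longrightarrow> aset \<G> (arc_rev (base \<G>) a) = aset \<G> a"
    and embedding: "a \<in> arcs (base \<G>) \<Longrightarrow>
      action_embedding (agroup \<G> a) (aset \<G> a)
        (vgroup \<G> (head (base \<G>) a)) (vset \<G> (head (base \<G>) a)) (emb \<G> a)"
    and agent_perm: "\<lbrakk>a \<in> arcs (base \<G>); arc_rev (base \<G>) a = a\<rbrakk> \<Longrightarrow>
      agent \<G> a \<in> Bij (aset \<G> a)"
    and agent_normalises: "\<lbrakk>a \<in> arcs (base \<G>); arc_rev (base \<G>) a = a\<rbrakk> \<Longrightarrow>
      (\<lambda>h. agent \<G> a \<otimes>\<^bsub>BijGroup (aset \<G> a)\<^esub> h
             \<otimes>\<^bsub>BijGroup (aset \<G> a)\<^esub> inv\<^bsub>BijGroup (aset \<G> a)\<^esub> agent \<G> a) ` agroup \<G> a = agroup \<G> a"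
    and agent_square: "\<lbrakk>a \<in> arcs (base \<G>); arc_rev (base \<G>) a = a\<rbrakk> \<Longrightarrow>
      agent \<G> a \<otimes>\<^bsub>BijGroup (aset \<G> a)\<^esub> agent \<G> a \<in> agroup \<G> a"

definition adhesion_maps :: "('v, 'a, 'x, 'y) pre_gga \<Rightarrow> 'a \<Rightarrow> ('y \<Rightarrow> 'x) set" where
  "adhesion_maps \<G> a =
     {compose (aset \<G> a) g (emb \<G> a) | g. g \<in> vgroup \<G> (head (base \<G>) a)}"

definition twisted_adhesion_maps :: "('v, 'a, 'x, 'y) pre_gga \<Rightarrow> 'a \<Rightarrow> ('y \<Rightarrow> 'x) set" where
  "twisted_adhesion_maps \<G> a =
     {compose (aset \<G> a) g (compose (aset \<G> a) (emb \<G> a) (agent \<G> a)) | g.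
        g \<in> vgroup \<G> (head (base \<G>) a)}"

definition adhesion_sets :: "('v, 'a, 'x, 'y) pre_gga \<Rightarrow> 'a \<Rightarrow> 'x set set" where
  "adhesion_sets \<G> a = (\<lambda>f. f ` aset \<G> a) ` adhesion_maps \<G> a"


section \<open>Scaffoldings and universal groups\<close>

definition arc_relation :: "('v, 'a) pre_rgraph \<Rightarrow> 'v rel \<Rightarrow> 'a rel" where
  "arc_relation \<Sigma> R = {(a, b). a \<in> arcs \<Sigma> \<and> b \<in> arcs \<Sigma> \<and>
     (tail \<Sigma> a, tail \<Sigma> b) \<in> R \<and> (head \<Sigma> a, head \<Sigma> b) \<in> R}"

text \<open>
  The vertices and arcs of the quotient are the equivalence classes themselves, so a class
  regarded as a set is not distinguished from the same class regarded as a vertex or arc.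
\<close>

definition quotient_rgraph :: "('v, 'a) pre_rgraph \<Rightarrow> 'v rel \<Rightarrow> ('v set, 'a set) pre_rgraph" where
  "quotient_rgraph \<Sigma> R =
     \<lparr>verts = verts \<Sigma> // R,
      arcs = arcs \<Sigma> // arc_relation \<Sigma> R,
      tail = (\<lambda>D. R `` (tail \<Sigma> ` D)),
      head = (\<lambda>D. R `` (head \<Sigma> ` D)),
      arc_rev = (\<lambda>D. arc_rev \<Sigma> ` D)\<rparr>"

text \<open>
  \<open>projV\<close>, \<open>projA\<close> are the vertex and arc parts of the projection to the base graph;
  \<open>labV\<close>, \<open>labA\<close> are the restrictions of the labelling \<open>p\<close> to vertices and arcs.
\<close>

record ('s, 'e, 'v, 'a, 'x, 'y) pre_scaffolding =
  sgraph :: "('s, 'e) pre_rgraph"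
  srel :: "'s rel"
  projV :: "'s set \<Rightarrow> 'v"
  projA :: "'e set \<Rightarrow> 'a"
  labV :: "'s \<Rightarrow> 'x"
  labA :: "'e \<Rightarrow> 'y"

definition assoc_tree ::
    "('s, 'e, 'v, 'a, 'x, 'y) pre_scaffolding \<Rightarrow> ('s set, 'e set) pre_rgraph" where
  "assoc_tree S = quotient_rgraph (sgraph S) (srel S)"

text \<open>
  The map sending the label of each arc \<open>b\<close> in the class \<open>D\<close> to the label of the terminus of \<open>b\<close>.
\<close>

definition scaffold_map ::
    "('v, 'a, 'x, 'y) pre_gga \<Rightarrow> ('s, 'e, 'v, 'a, 'x, 'y) pre_scaffolding \<Rightarrow> 'e set \<Rightarrow> 'y \<Rightarrow> 'x" where
  "scaffold_map \<G> S D =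
     (\<lambda>y\<in>aset \<G> (projA S D). labV S (head (sgraph S) (inv_into D (labA S) y)))"

locale scaffolding =
  fixes \<G> :: "('v, 'a, 'x, 'y) pre_gga"
    and S :: "('s, 'e, 'v, 'a, 'x, 'y) pre_scaffolding"
  assumes sgraph_rgraph: "rgraph (sgraph S)"
    and srel_equiv: "equiv (verts (sgraph S)) (srel S)"
    and assoc_tree_rtree: "rtree (assoc_tree S)"
    and no_inner_arc: "b \<in> arcs (sgraph S) \<Longrightarrow>
      (tail (sgraph S) b, head (sgraph S) b) \<notin> srel S"
    and proj_hom: "rgraph_hom (assoc_tree S) (base \<G>) (projV S) (projA S)"
    and labV_bij: "C \<in> verts (assoc_tree S) \<Longrightarrow> bij_betw (labV S) C (vset \<G> (projV S C))"
    and labA_bij: "D \<in> arcs (assoc_tree S) \<Longrightarrow> bij_betw (labA S) D (aset \<G> (projA S D))"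
    and labA_rev: "b \<in> arcs (sgraph S) \<Longrightarrow> labA S (arc_rev (sgraph S) b) = labA S b"
    and map_adhesion:
      "\<lbrakk>D \<in> arcs (assoc_tree S); arc_rev (base \<G>) (projA S D) \<noteq> projA S D\<rbrakk> \<Longrightarrow>
        scaffold_map \<G> S D \<in> adhesion_maps \<G> (projA S D)"
    and map_self_rev:
      "\<lbrakk>D \<in> arcs (assoc_tree S); arc_rev (base \<G>) (projA S D) = projA S D\<rbrakk> \<Longrightarrow>
        scaffold_map \<G> S D \<in> adhesion_maps \<G> (projA S D) \<and>
        scaffold_map \<G> S (arc_rev (assoc_tree S) D) \<in> twisted_adhesion_maps \<G> (projA S D)
        \<or>
        scaffold_map \<G> S D \<in> twisted_adhesion_maps \<G> (projA S D) \<and>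
        scaffold_map \<G> S (arc_rev (assoc_tree S) D) \<in> adhesion_maps \<G> (projA S D)"
    and unique_arc:
      "\<lbrakk>C \<in> verts (assoc_tree S); a \<in> arcs (base \<G>); head (base \<G>) a = projV S C;
        Z \<in> adhesion_sets \<G> a\<rbrakk> \<Longrightarrow>
        \<exists>!D. D \<in> arcs (assoc_tree S) \<and> head (assoc_tree S) D = C \<and> projA S D = a \<and>
             scaffold_map \<G> S D ` aset \<G> a = Z"

definition local_perm ::
    "('v, 'a, 'x, 'y) pre_gga \<Rightarrow> ('s, 'e, 'v, 'a, 'x, 'y) pre_scaffolding \<Rightarrow>
     ('s \<Rightarrow> 's) \<times> ('e \<Rightarrow> 'e) \<Rightarrow> 's set \<Rightarrow> 'x \<Rightarrow> 'x" where
  "local_perm \<G> S g C =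
     (\<lambda>z\<in>vset \<G> (projV S C). labV S (fst g (inv_into C (labV S) z)))"

definition universal_group ::
    "('v, 'a, 'x, 'y) pre_gga \<Rightarrow> ('s, 'e, 'v, 'a, 'x, 'y) pre_scaffolding \<Rightarrow>
     (('s \<Rightarrow> 's) \<times> ('e \<Rightarrow> 'e)) monoid" where
  "universal_group \<G> S =
     (aut_group (sgraph S)) \<lparr>carrier := {g \<in> rgraph_auts (sgraph S).
        (\<forall>u\<in>verts (sgraph S). \<forall>w\<in>verts (sgraph S).
           (fst g u, fst g w) \<in> srel S \<longleftrightarrow> (u, w) \<in> srel S) \<and>
        (\<forall>C\<in>verts (assoc_tree S). projV S (fst g ` C) = projV S C) \<and>
        (\<forall>D\<in>arcs (assoc_tree S). projA S (snd g ` D) = projA S D) \<and>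
        (\<forall>C\<in>verts (assoc_tree S). local_perm \<G> S g C \<in> vgroup \<G> (projV S C))}\<rparr>"

definition assoc_tree_action ::
    "('s, 'e, 'v, 'a, 'x, 'y) pre_scaffolding \<Rightarrow> ('s \<Rightarrow> 's) \<times> ('e \<Rightarrow> 'e) \<Rightarrow>
     ('s set \<Rightarrow> 's set) \<times> ('e set \<Rightarrow> 'e set)" where
  "assoc_tree_action S g =
     (\<lambda>C\<in>verts (assoc_tree S). fst g ` C, \<lambda>D\<in>arcs (assoc_tree S). snd g ` D)"


section \<open>The graph of group actions of a permutation group\<close>

definition burger_mozes_gga ::
    "'x set \<Rightarrow> ('x \<Rightarrow> 'x) set \<Rightarrow> 'i set \<Rightarrow> ('i \<Rightarrow> 'x) \<Rightarrow> (unit, 'i, 'x, 'x) pre_gga" where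
  "burger_mozes_gga X F I x =
     \<lparr>base = \<lparr>verts = {()}, arcs = I, tail = (\<lambda>_. ()), head = (\<lambda>_. ()), arc_rev = (\<lambda>i. i)\<rparr>,
      vgroup = (\<lambda>_. F),
      vset = (\<lambda>_. X),
      agroup = (\<lambda>i. {\<one>\<^bsub>BijGroup {x i}\<^esub>}),
      aset = (\<lambda>i. {x i}),
      emb = (\<lambda>i y. y),
      agent = (\<lambda>i. \<one>\<^bsub>BijGroup {x i}\<^esub>)\<rparr>"

lemma burger_mozes_gga_is_gga:
  assumes "X \<noteq> {}" and F: "subgroup F (BijGroup X)" and x: "\<And>i. i \<in> I \<Longrightarrow> x i \<in> X"
  shows "gga (burger_mozes_gga X F I x)"
proof -
  let ?G = "burger_mozes_gga X F I x"
  have wf: "wf_digraph (digraph_of (base ?G))"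
    by (simp add: burger_mozes_gga_def pre_digraph.truncate_def wf_digraph_def)
  have rg: "rgraph (base ?G)"
    by (rule rgraph.intro, rule wf) (simp_all add: burger_mozes_gga_def)
  have con: "connected (digraph_of (base ?G))"
    by (auto simp: burger_mozes_gga_def connected_def strongly_connected_def mk_symmetric_def
        reachable_def pre_digraph.truncate_def)
  have triv: "subgroup {\<one>\<^bsub>BijGroup {x i}\<^esub>} (BijGroup {x i})" for i
    by (rule group.triv_subgroup) (rule group_BijGroup)
  have one: "\<one>\<^bsub>BijGroup {x i}\<^esub> = (\<lambda>z\<in>{x i}. z)" for i
    by (simp add: BijGroup_def)
  have ind: "induced_perm_group F {x i} = {\<one>\<^bsub>BijGroup {x i}\<^esub>}" if "i \<in> I" for i
  proof (rule equalityI; rule subsetI)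
    fix g assume "g \<in> induced_perm_group F {x i}"
    then obtain f where f: "g = restrict f {x i}" "f ` {x i} = {x i}"
      unfolding induced_perm_group_def by blast
    then have "f (x i) = x i" by simp
    then have "restrict f {x i} = (\<lambda>z\<in>{x i}. z)" by (intro restrict_ext) simp
    with f one[of i] show "g \<in> {\<one>\<^bsub>BijGroup {x i}\<^esub>}" by (metis singletonI)
  next
    let ?e = "\<one>\<^bsub>BijGroup X\<^esub>"
    fix g assume g: "g \<in> {\<one>\<^bsub>BijGroup {x i}\<^esub>}"
    have "?e \<in> F" using F by (rule subgroup.one_closed)
    moreover have e: "?e (x i) = x i" using x[OF that] by (simp add: BijGroup_def)
    moreover have "restrict ?e {x i} = (\<lambda>z\<in>{x i}. z)"
      using e by (intro restrict_ext) simp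
    moreover have "?e ` {x i} = {x i}" by (simp only: image_insert image_empty e)
    ultimately have "(\<lambda>z\<in>{x i}. z) \<in> induced_perm_group F {x i}"
      unfolding induced_perm_group_def mem_Collect_eq by metis
    moreover have "g = (\<lambda>z\<in>{x i}. z)" using g unfolding one singleton_iff .
    ultimately show "g \<in> induced_perm_group F {x i}" by (simp only:)
  qed
  have one_Bij: "\<one>\<^bsub>BijGroup {x i}\<^esub> \<in> Bij {x i}" for i
    by (simp add: BijGroup_def id_Bij)
  have mon: "monoid (BijGroup {x i})" for i
    using group_BijGroup by (rule group.is_monoid)
  have sq: "\<one>\<^bsub>BijGroup {x i}\<^esub> \<otimes>\<^bsub>BijGroup {x i}\<^esub> \<one>\<^bsub>BijGroup {x i}\<^esub> = \<one>\<^bsub>BijGroup {x i}\<^esub>" for i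
    by (rule monoid.l_one[OF mon monoid.one_closed[OF mon]])
  have inv1: "inv\<^bsub>BijGroup {x i}\<^esub> \<one>\<^bsub>BijGroup {x i}\<^esub> = \<one>\<^bsub>BijGroup {x i}\<^esub>" for i
    by (rule monoid.inv_one[OF mon])
  have emb: "action_embedding {\<one>\<^bsub>BijGroup {x i}\<^esub>} {x i} F X (\<lambda>y. y)" if "i \<in> I" for i
  proof -
    have inv_x: "inv_into {x i} (\<lambda>y. y) (x i) = x i"
      by (rule inv_into_f_f[where f = "\<lambda>y. y"]) simp_all
    have "(\<lambda>z\<in>{x i}. \<one>\<^bsub>BijGroup {x i}\<^esub> (inv_into {x i} (\<lambda>y. y) z)) = (\<lambda>z\<in>{x i}. z)"
      by (intro restrict_ext) (simp add: one inv_x)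
    then have conj: "(\<lambda>z\<in>{x i}. \<one>\<^bsub>BijGroup {x i}\<^esub> (inv_into {x i} (\<lambda>y. y) z)) = \<one>\<^bsub>BijGroup {x i}\<^esub>"
      by (simp only: one)
    show ?thesis
      unfolding action_embedding_def iso_def hom_def bij_betw_def image_ident ind[OF that]
      using x[OF that] by (simp add: conj sq)
  qed
  have pF: "perm_group_action F X"
    unfolding perm_group_action_def using assms(1) F by (rule conjI)
  have p1: "perm_group_action {\<one>\<^bsub>BijGroup {x i}\<^esub>} {x i}" for i
    unfolding perm_group_action_def by (rule conjI[OF insert_not_empty triv])
  show ?thesis
    by (rule gga.intro, rule rg, rule con)
      (simp_all add: burger_mozes_gga_def pF p1 emb one_Bij sq inv1)
qed

end

theory Submission
  imports Defs
begin

text \<open>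
  The adhesion sets of the given graph of group actions are the singletons, so every arc class of
  the scaffolding \<open>S\<close> is a single arc, and labelling it by the label of its terminus colours the
  arcs of the associated tree. This colouring is bijective on stars, but the colours of an arc and
  of its reverse need only lie in the same \<open>F\<close>-orbit. The universal group consists of the
  automorphisms of the associated tree whose local permutations in this colouring lie in \<open>F\<close>.
  Since closed walks in a tree backtrack, one can transport elements of \<open>F\<close> along the tree to
  recolour each star by an element of \<open>F\<close> so that the colouring becomes legal; this does not change
  the group. Transporting vertices instead shows that any two trees with legal colourings
  by the same set are isomorphic as coloured trees, and conjugation by such an isomorphism carries
  the universal group to \<open>U(F)\<close>.
\<close>

section \<open>Transport along the arcs of a tree\<close>

text \<open>The first obstacle is reversal. Every base arc is a self-reverse loop with identity
  inversion agent, so a scaffolding says only that an arc and its reverse lie over the same loop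
  \<open>i\<close> and that both colours have the form \<open>g (x i)\<close> with \<open>g\<close>
  in \<open>F\<close>. The mismatch of the two colours is thus bridged by an element of
  \<open>F\<close>. Recolouring the star at each \<open>v\<close> by \<open>f v\<close> in
  \<open>F\<close> turns the local permutation \<sigma> of \<open>g\<close> at \<open>v\<close> into
  \<open>f (g v) \<sigma> (f v)^-1\<close>, which is in \<open>F\<close> exactly when \<sigma> is.
  For this reason Burger-Mozes groups are studied for colourings that are merely bijective on stars,
  a class containing both the colouring by labels and the legal one.

  The second obstacle is that the universal group acts on the scaffolding and not on its quotient.
  Labels biject a vertex class with \<open>X\<close> and colours biject the star of that class with
  \<open>X\<close>, so each vertex of the scaffolding is the terminus of exactly one arc. Passing to
  the quotient therefore loses nothing, and every automorphism of the tree lifts uniquely.\<close>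

lemma digraph_of_simps [simp]:
  "verts (digraph_of G) = verts G" "arcs (digraph_of G) = arcs G"
  "tail (digraph_of G) = tail G" "head (digraph_of G) = head G"
  by (simp_all add: pre_digraph.truncate_def)

context rgraph
begin

sublocale D: wf_digraph "digraph_of G"
  by (rule wf)

lemma tail_in [simp]: "a \<in> arcs G \<Longrightarrow> tail G a \<in> verts G"
  using D.tail_in_verts by simp

lemma head_in [simp]: "a \<in> arcs G \<Longrightarrow> head G a \<in> verts G"
  using D.head_in_verts by simp

lemma head_rev [simp]: "a \<in> arcs G \<Longrightarrow> head G (arc_rev G a) = tail G a"
  using tail_eq_head_rev by simp

lemma tail_rev [simp]: "a \<in> arcs G \<Longrightarrow> tail G (arc_rev G a) = head G a"
  using tail_eq_head_rev[of "arc_rev G a"] rev_in_arcs rev_rev by simp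

declare rev_in_arcs [simp] rev_rev [simp]

lemma symmetric_digraph_of: "symmetric (digraph_of G)"
  unfolding symmetric_conv
proof
  fix a assume "a \<in> arcs (digraph_of G)"
  then show "\<exists>b\<in>arcs (digraph_of G). tail (digraph_of G) a = head (digraph_of G) b \<and>
      head (digraph_of G) a = tail (digraph_of G) b"
    by (intro bexI[of _ "arc_rev G a"]) simp_all
qed

text \<open>Connectedness in the library concerns the symmetric closure. Arc reversal makes the
  digraph symmetric already, so directed walks exist between any two vertices.\<close>

lemma connected_awalk:
  assumes "connected (digraph_of G)" "u \<in> verts G" "v \<in> verts G"
  obtains p where "D.awalk u p v"
  using D.symmetric_connected_imp_strongly_connected[OF symmetric_digraph_of assms(1)] assms(2,3)
  unfolding strongly_connected_def D.reachable_awalk by auto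

lemma connected_induct:
  assumes "connected (digraph_of G)" "v\<^sub>0 \<in> verts G" "v \<in> verts G"
    and "P v\<^sub>0" and step: "\<And>a. a \<in> arcs G \<Longrightarrow> P (tail G a) \<Longrightarrow> P (head G a)"
  shows "P v"
proof -
  obtain p where "D.awalk v\<^sub>0 p v" using assms connected_awalk by blast
  then show ?thesis using \<open>P v\<^sub>0\<close>
    by (induction p arbitrary: v\<^sub>0) (auto simp: D.awalk_simps intro: step)
qed

end

context rtree
begin

lemma verts_nonempty: "verts T \<noteq> {}"
  using connected unfolding connected_def strongly_connected_def by simp

text \<open>Induction on the length: a closed walk without repeated vertices is a cycle and so is
  short; any other contains a closed walk that avoids its first arc, hence a shorter one.\<close>

lemma closed_awalk_backtracks:
  assumes "D.awalk u p u" "p \<noteq> []"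
  obtains p\<^sub>1 a p\<^sub>2 where "p = p\<^sub>1 @ [a, arc_rev T a] @ p\<^sub>2" "a \<in> arcs T"
proof -
  have "\<exists>p\<^sub>1 a p\<^sub>2. p = p\<^sub>1 @ [a, arc_rev T a] @ p\<^sub>2 \<and> a \<in> arcs T"
    using assms
  proof (induction p arbitrary: u rule: length_induct)
    case (1 p)
    then obtain a q where p: "p = a # q" by (cases p) auto
    have a: "a \<in> arcs T" "tail T a = u" and q: "D.awalk (head T a) q u"
      using "1.prems"(1) by (auto simp: p D.awalk_simps)
    show ?case
    proof (cases "distinct (D.awalk_verts (head T a) q)")
      case True
      then have "D.cycle p"
        using "1.prems" unfolding D.cycle_def by (auto simp: p)
      \<comment> \<open>The cycle has length at most 2. Length 1 would be a loop, and in length 2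
        the second arc must be the reverse of the first, because parallel arcs are excluded.\<close>
      then have "length q < 2" using no_cycle by (force simp: p)
      moreover have "q \<noteq> []"
        using q a loopfree_digraph.no_loops[OF loopfree, of a] by (auto simp: D.awalk_simps)
      ultimately obtain b where b: "q = [b]"
        by (metis One_nat_def Suc_length_conv length_0_conv less_2_cases_iff)
      have "b \<in> arcs T" "tail T b = head T a" "head T b = u"
        using q by (auto simp: b D.awalk_simps)
      then have "b = arc_rev T a"
        using nomulti_digraph.no_multi_arcs[OF nomulti, of b "arc_rev T a"] a
        by (simp add: arc_to_ends_def)
      then have "p = [] @ [a, arc_rev T a] @ []" by (simp add: p b)
      then show ?thesis using a by blast
    next
      case False
      then obtain q\<^sub>1 r q\<^sub>2 w where r: "q = q\<^sub>1 @ r @ q\<^sub>2" "r \<noteq> []" "D.awalk w r w"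
        using D.awalk_not_distinct_decomp[OF q] by auto
      then obtain r\<^sub>1 b r\<^sub>2 where b: "r = r\<^sub>1 @ [b, arc_rev T b] @ r\<^sub>2" "b \<in> arcs T"
        using "1.IH"[rule_format, of r w] by (auto simp: p)
      then have "p = (a # q\<^sub>1 @ r\<^sub>1) @ [b, arc_rev T b] @ (r\<^sub>2 @ q\<^sub>2)"
        by (simp add: p r)
      then show ?thesis using b by blast
    qed
  qed
  then show ?thesis using that by blast
qed

text \<open>
  Arcs act on a set of states so that an arc and its reverse cancel. Since closed walks in a tree
  reduce to the empty walk by cancelling backtracks, states can be assigned to the vertices
  consistently.
\<close>

lemma transport:
  assumes \<tau>: "\<And>a q. a \<in> arcs T \<Longrightarrow> q \<in> Q \<Longrightarrow> \<tau> a q \<in> Q"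
    and cancel: "\<And>a q. a \<in> arcs T \<Longrightarrow> q \<in> Q \<Longrightarrow> \<tau> (arc_rev T a) (\<tau> a q) = q"
    and v\<^sub>0: "v\<^sub>0 \<in> verts T" and q\<^sub>0: "q\<^sub>0 \<in> Q"
  obtains s where "s \<in> verts T \<rightarrow> Q" "s v\<^sub>0 = q\<^sub>0"
    "\<And>a. a \<in> arcs T \<Longrightarrow> s (head T a) = \<tau> a (s (tail T a))"
proof -
  have mem: "fold \<tau> p q \<in> Q" if "set p \<subseteq> arcs T" "q \<in> Q" for p q
    using that by (induction p arbitrary: q) (auto simp: \<tau>)
  have closed: "fold \<tau> p q = q" if "D.awalk u p u" "q \<in> Q" for u p q
    using that
  proof (induction p arbitrary: u rule: length_induct)
    case (1 p)
    show ?case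
    proof (cases "p = []")
      case False
      then obtain p\<^sub>1 a p\<^sub>2 where p: "p = p\<^sub>1 @ [a, arc_rev T a] @ p\<^sub>2" and a: "a \<in> arcs T"
        using closed_awalk_backtracks "1.prems"(1) by blast
      have w: "D.awalk u (p\<^sub>1 @ p\<^sub>2) u"
        using "1.prems"(1) a by (auto simp: p D.awalk_simps)
      have "set p\<^sub>1 \<subseteq> arcs T" using "1.prems"(1) by (auto simp: p D.awalk_def)
      then have "fold \<tau> p q = fold \<tau> (p\<^sub>1 @ p\<^sub>2) q"
        using cancel[OF a mem[OF _ "1.prems"(2)]] by (simp add: p)
      also have "\<dots> = q"
        using "1.IH"[rule_format, of "p\<^sub>1 @ p\<^sub>2" u] w "1.prems"(2) by (simp add: p)
      finally show ?thesis .
    qed simp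
  qed
  \<comment> \<open>On \<open>Q\<close> each \<tau> \<open>a\<close> has the left inverse \<tau>
    \<open>(arc_rev T a)\<close>, so following a walk is injective.\<close>
  have inj: "q = q'" if "set p \<subseteq> arcs T" "q \<in> Q" "q' \<in> Q" "fold \<tau> p q = fold \<tau> p q'" for p q q'
    using that
  proof (induction p arbitrary: q q')
    case (Cons a p)
    have "\<tau> a q = \<tau> a q'" by (rule Cons.IH) (use Cons.prems \<tau> in auto)
    then have "\<tau> (arc_rev T a) (\<tau> a q) = \<tau> (arc_rev T a) (\<tau> a q')" by simp
    then show ?case using Cons.prems by (simp add: cancel)
  qed simp
  \<comment> \<open>Both walks are closed up by the same return walk \<open>r\<close>; injectivity
    along \<open>r\<close> then cancels it.\<close>
  have indep: "fold \<tau> p q\<^sub>0 = fold \<tau> p' q\<^sub>0" if walks: "D.awalk v\<^sub>0 p v" "D.awalk v\<^sub>0 p' v" for p p' v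
  proof -
    have "v \<in> verts T" using D.awalk_last_in_verts[OF walks(1)] by simp
    then obtain r where r: "D.awalk v r v\<^sub>0"
      using connected_awalk[OF connected _ v\<^sub>0] by blast
    have "D.awalk v\<^sub>0 (p @ r) v\<^sub>0" "D.awalk v\<^sub>0 (p' @ r) v\<^sub>0" using walks r by auto
    from this[THEN closed[OF _ q\<^sub>0]]
    have "fold \<tau> r (fold \<tau> p q\<^sub>0) = fold \<tau> r (fold \<tau> p' q\<^sub>0)" by simp
    then show ?thesis
      by (rule inj[of r, rotated 3]) (use r walks q\<^sub>0 in \<open>auto simp: D.awalk_def intro: mem\<close>)
  qed
  define s where "s v = fold \<tau> (SOME p. D.awalk v\<^sub>0 p v) q\<^sub>0" for v
  have s: "s v = fold \<tau> p q\<^sub>0" if "D.awalk v\<^sub>0 p v" for p v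
    unfolding s_def
    using indep[OF someI[of "\<lambda>p. D.awalk v\<^sub>0 p v", OF that] that] .
  show thesis
  proof
    show "s v\<^sub>0 = q\<^sub>0" using s[of "[]"] v\<^sub>0 by (simp add: D.awalk_simps)
    show "s \<in> verts T \<rightarrow> Q"
    proof
      fix v assume "v \<in> verts T"
      then obtain p where p: "D.awalk v\<^sub>0 p v" using connected_awalk[OF connected v\<^sub>0] by blast
      then show "s v \<in> Q" using s[OF p] mem[OF _ q\<^sub>0] by (auto simp: D.awalk_def)
    qed
    fix a assume a: "a \<in> arcs T"
    then obtain p where p: "D.awalk v\<^sub>0 p (tail T a)"
      using connected_awalk[OF connected v\<^sub>0] tail_in by blast
    then have "D.awalk v\<^sub>0 (p @ [a]) (head T a)" using a by (simp add: D.awalk_simps)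
    from s[OF this] s[OF p] show "s (head T a) = \<tau> a (s (tail T a))" by simp
  qed
qed

end

section \<open>Colourings\<close>

text \<open>An isomorphism is recorded together with its inverse, so that exchanging the two maps
  converts each statement about one direction into the other, and conjugation needs no
  \<open>inv_into\<close>.\<close>

definition inverse_homs ::
    "('v, 'a) pre_rgraph \<Rightarrow> ('w, 'b) pre_rgraph \<Rightarrow> ('v \<Rightarrow> 'w) \<times> ('a \<Rightarrow> 'b) \<Rightarrow>
     ('w \<Rightarrow> 'v) \<times> ('b \<Rightarrow> 'a) \<Rightarrow> bool" where
  "inverse_homs G H \<Phi> \<Psi> \<longleftrightarrow>
     rgraph_hom G H (fst \<Phi>) (snd \<Phi>) \<and> rgraph_hom H G (fst \<Psi>) (snd \<Psi>) \<and>
     (\<forall>v\<in>verts G. fst \<Psi> (fst \<Phi> v) = v) \<and> (\<forall>a\<in>arcs G. snd \<Psi> (snd \<Phi> a) = a) \<and>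
     (\<forall>w\<in>verts H. fst \<Phi> (fst \<Psi> w) = w) \<and> (\<forall>b\<in>arcs H. snd \<Phi> (snd \<Psi> b) = b)"

lemma inverse_homs_sym: "inverse_homs G H \<Phi> \<Psi> \<Longrightarrow> inverse_homs H G \<Psi> \<Phi>"
  unfolding inverse_homs_def by blast

lemma inverse_homs_iso: "inverse_homs G H \<Phi> \<Psi> \<Longrightarrow> rgraph_iso G H (fst \<Phi>) (snd \<Phi>)"
  unfolding inverse_homs_def rgraph_iso_def rgraph_hom_def
  by (auto intro!: bij_betw_byWitness[where f' = "fst \<Psi>"] bij_betw_byWitness[where f' = "snd \<Psi>"])

text \<open>A legal colouring without invariance under reversal: this is all that the colouring by
  labels of termini satisfies before it is corrected.\<close>

definition star_colouring :: "'x set \<Rightarrow> ('v, 'a) pre_rgraph \<Rightarrow> ('a \<Rightarrow> 'x) \<Rightarrow> bool" where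
  "star_colouring X G c \<longleftrightarrow> (\<forall>v\<in>verts G. bij_betw c (Star G v) X)"

lemma star_colouringD: "star_colouring X G c \<Longrightarrow> v \<in> verts G \<Longrightarrow> bij_betw c (Star G v) X"
  by (simp add: star_colouring_def)

lemma (in rgraph) star_colouring_in: "star_colouring X G c \<Longrightarrow> a \<in> arcs G \<Longrightarrow> c a \<in> X"
  using star_colouringD[of X G c "head G a"] by (auto dest: bij_betwE)

lemma legal_colouringD:
  assumes "legal_colouring X G c"
  shows "star_colouring X G c" "a \<in> arcs G \<Longrightarrow> c (arc_rev G a) = c a"
  using assms by (simp_all add: legal_colouring_def star_colouring_def)

section \<open>Existence and rigidity of colour-preserving morphisms\<close>

lemma colour_preserving_hom_exists:
  assumes "rtree T" "legal_colouring X T c" "rgraph T'" "legal_colouring X T' c'"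
    and v\<^sub>0: "v\<^sub>0 \<in> verts T" and w\<^sub>0: "w\<^sub>0 \<in> verts T'"
  obtains \<Phi>V \<Phi>A where "rgraph_hom T T' \<Phi>V \<Phi>A" "\<And>a. a \<in> arcs T \<Longrightarrow> c' (\<Phi>A a) = c a"
    "\<Phi>V v\<^sub>0 = w\<^sub>0"
proof -
  interpret T: rtree T by fact
  interpret T': rgraph T' by fact
  note c_rev = legal_colouringD(2)[OF assms(2)] and c'_rev = legal_colouringD(2)[OF assms(4)]
  note c_in = T.star_colouring_in[OF legal_colouringD(1)[OF assms(2)]]
  note c'_bij = star_colouringD[OF legal_colouringD(1)[OF assms(4)]]
  define arc where "arc w z = inv_into (Star T' w) c' z" for w z
  have arc: "arc w z \<in> arcs T'" "head T' (arc w z) = w" "c' (arc w z) = z"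
    if "w \<in> verts T'" "z \<in> X" for w z
  proof -
    have z: "z \<in> c' ` Star T' w" using c'_bij[OF that(1)] that(2) by (simp add: bij_betw_def)
    from inv_into_into[OF z] show "arc w z \<in> arcs T'" "head T' (arc w z) = w"
      by (simp_all add: arc_def)
    from f_inv_into_f[OF z] show "c' (arc w z) = z" by (simp add: arc_def)
  qed
  have arc_eq: "arc (head T' b) (c' b) = b" if "b \<in> arcs T'" for b
    unfolding arc_def using c'_bij[of "head T' b"] that
    by (intro inv_into_f_f) (auto simp: bij_betw_def)
  have arc_rev_eq: "arc (tail T' (arc w z)) z = arc_rev T' (arc w z)"
    if "w \<in> verts T'" "z \<in> X" for w z
    using arc_eq[of "arc_rev T' (arc w z)"] arc[OF that] by (simp add: c'_rev)
  \<comment> \<open>The states are the vertices of \<open>T'\<close>: crossing \<open>a\<close>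
    moves \<open>w\<close> to its neighbour along the arc of colour \<open>c a\<close> ending in
    \<open>w\<close>. Since the reverse arc has the same colour in both graphs, crossing it leads
    back.\<close>
  obtain s where s: "s \<in> verts T \<rightarrow> verts T'" "s v\<^sub>0 = w\<^sub>0"
    "\<And>a. a \<in> arcs T \<Longrightarrow> s (head T a) = tail T' (arc (s (tail T a)) (c a))"
  proof (rule T.transport[where Q = "verts T'" and \<tau> = "\<lambda>a w. tail T' (arc w (c a))"])
    fix a w assume a: "a \<in> arcs T" and w: "w \<in> verts T'"
    show "tail T' (arc w (c a)) \<in> verts T'" using arc(1)[OF w c_in[OF a]] by simp
    show "tail T' (arc (tail T' (arc w (c a))) (c (arc_rev T a))) = w"
      using arc[OF w c_in[OF a]] by (simp add: c_rev[OF a] arc_rev_eq[OF w c_in[OF a]])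
  qed (use v\<^sub>0 w\<^sub>0 in auto)
  have s_in: "s v \<in> verts T'" if "v \<in> verts T" for v using s(1) that by blast
  have s_tail: "s (tail T a) = tail T' (arc (s (head T a)) (c a))" if "a \<in> arcs T" for a
    using s(3)[of "arc_rev T a"] that by (simp add: c_rev)
  show thesis
  proof
    show "rgraph_hom T T' s (\<lambda>a. arc (s (head T a)) (c a))"
      unfolding rgraph_hom_def
      using s(1) by (auto simp: arc s_in c_in s_tail c_rev arc_rev_eq)
    show "c' (arc (s (head T a)) (c a)) = c a" if "a \<in> arcs T" for a
      using that by (simp add: arc s_in c_in)
  qed (rule s(2))
qed

text \<open>At a fixed vertex every arc of the star is fixed, because colours are injective there;
  hence its neighbours are fixed too, and connectedness spreads this everywhere.\<close>

lemma colour_preserving_hom_id: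
  assumes "rgraph T" "connected (digraph_of T)" "legal_colouring X T c"
    and hom: "rgraph_hom T T \<Phi>V \<Phi>A" and col: "\<And>a. a \<in> arcs T \<Longrightarrow> c (\<Phi>A a) = c a"
    and v\<^sub>0: "v\<^sub>0 \<in> verts T" "\<Phi>V v\<^sub>0 = v\<^sub>0"
  shows "v \<in> verts T \<Longrightarrow> \<Phi>V v = v" and "a \<in> arcs T \<Longrightarrow> \<Phi>A a = a"
proof -
  interpret T: rgraph T by fact
  have arc_fixed: "\<Phi>A a = a" if a: "a \<in> arcs T" and fixed: "\<Phi>V (head T a) = head T a" for a
  proof -
    have "bij_betw c (Star T (head T a)) X"
      using star_colouringD[OF legal_colouringD(1)[OF assms(3)]] a by simp
    then have "inj_on c (Star T (head T a))" by (rule bij_betw_imp_inj_on)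
    moreover have "\<Phi>A a \<in> Star T (head T a)" "a \<in> Star T (head T a)"
      using hom a fixed unfolding rgraph_hom_def by auto
    ultimately show ?thesis using col[OF a] unfolding inj_on_def by blast
  qed
  show vert_fixed: "\<Phi>V v = v" if "v \<in> verts T" for v
  proof (rule T.connected_induct[OF assms(2) v\<^sub>0(1) that, where P = "\<lambda>v. \<Phi>V v = v"])
    fix a assume a: "a \<in> arcs T" and "\<Phi>V (tail T a) = tail T a"
    then have "\<Phi>A (arc_rev T a) = arc_rev T a" by (intro arc_fixed) simp_all
    moreover have "tail T (\<Phi>A (arc_rev T a)) = \<Phi>V (head T a)"
      using hom a unfolding rgraph_hom_def by simp
    ultimately show "\<Phi>V (head T a) = head T a" using a by simp
  qed (rule v\<^sub>0(2))
  show "\<Phi>A a = a" if "a \<in> arcs T" for a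
    using that by (intro arc_fixed vert_fixed) simp_all
qed

lemma rgraph_hom_comp:
  "rgraph_hom G H fV fA \<Longrightarrow> rgraph_hom H K gV gA \<Longrightarrow> rgraph_hom G K (gV \<circ> fV) (gA \<circ> fA)"
  unfolding rgraph_hom_def by (auto simp: Pi_iff)

text \<open>Colour-preserving morphisms in both directions are chosen with matching base vertices,
  so both composites fix a vertex and rigidity makes them identities.\<close>

lemma legal_colouring_unique:
  assumes "rtree T" "legal_colouring X T c" "rtree T'" "legal_colouring X T' c'"
  shows "\<exists>\<Phi> \<Psi>. inverse_homs T T' \<Phi> \<Psi> \<and> (\<forall>a\<in>arcs T. c' (snd \<Phi> a) = c a)"
proof -
  interpret T: rtree T by fact
  interpret T': rtree T' by fact
  obtain v\<^sub>0 w\<^sub>0 where v\<^sub>0: "v\<^sub>0 \<in> verts T" and w\<^sub>0: "w\<^sub>0 \<in> verts T'"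
    using T.verts_nonempty T'.verts_nonempty by blast
  obtain \<Phi>V \<Phi>A where \<Phi>: "rgraph_hom T T' \<Phi>V \<Phi>A" "\<And>a. a \<in> arcs T \<Longrightarrow> c' (\<Phi>A a) = c a"
    "\<Phi>V v\<^sub>0 = w\<^sub>0"
    using colour_preserving_hom_exists[OF assms(1,2) T'.rgraph_axioms assms(4) v\<^sub>0 w\<^sub>0] by blast
  obtain \<Psi>V \<Psi>A where \<Psi>: "rgraph_hom T' T \<Psi>V \<Psi>A" "\<And>b. b \<in> arcs T' \<Longrightarrow> c (\<Psi>A b) = c' b"
    "\<Psi>V w\<^sub>0 = v\<^sub>0"
    using colour_preserving_hom_exists[OF assms(3,4) T.rgraph_axioms assms(2) w\<^sub>0 v\<^sub>0] by blast
  have \<Phi>A: "\<Phi>A a \<in> arcs T'" if "a \<in> arcs T" for a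
    using \<Phi>(1) that unfolding rgraph_hom_def by blast
  have \<Psi>A: "\<Psi>A b \<in> arcs T" if "b \<in> arcs T'" for b
    using \<Psi>(1) that unfolding rgraph_hom_def by blast
  note idT = colour_preserving_hom_id[OF T.rgraph_axioms T.connected assms(2)
      rgraph_hom_comp[OF \<Phi>(1) \<Psi>(1)] _ v\<^sub>0]
  note idT' = colour_preserving_hom_id[OF T'.rgraph_axioms T'.connected assms(4)
      rgraph_hom_comp[OF \<Psi>(1) \<Phi>(1)] _ w\<^sub>0]
  have "inverse_homs T T' (\<Phi>V, \<Phi>A) (\<Psi>V, \<Psi>A)"
    unfolding inverse_homs_def
    using \<Phi>(1) \<Psi>(1) idT idT' by (auto simp: \<Phi>A \<Psi>A \<Phi>(2,3) \<Psi>(2,3))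
  then show ?thesis using \<Phi>(2) by (intro exI conjI) auto
qed

section \<open>Correcting a colouring by elements of the permutation group\<close>

lemma BijGroup_mult_apply:
  "\<lbrakk>f \<in> Bij X; g \<in> Bij X; y \<in> X\<rbrakk> \<Longrightarrow> (f \<otimes>\<^bsub>BijGroup X\<^esub> g) y = f (g y)"
  by (simp add: BijGroup_def compose_eq)

text \<open>
  Transport yields \<open>f\<close> with \<open>f (head a) * k a = f (tail a) * k (rev a)\<close> in \<open>F\<close>; evaluating both sides
  at \<open>r a\<close> shows that \<open>a\<close> and its reverse get the same new colour.
\<close>

lemma legal_colouring_of_orbit_colouring:
  assumes "rtree T" and F: "subgroup F (BijGroup X)"
    and star: "star_colouring X T d"
    and k: "\<And>a. a \<in> arcs T \<Longrightarrow> k a \<in> F" "\<And>a. a \<in> arcs T \<Longrightarrow> k a (r a) = d a"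
    and r: "\<And>a. a \<in> arcs T \<Longrightarrow> r a \<in> X" "\<And>a. a \<in> arcs T \<Longrightarrow> r (arc_rev T a) = r a"
  obtains f where "f \<in> verts T \<rightarrow> F" "legal_colouring X T (\<lambda>a. f (head T a) (d a))"
proof -
  interpret T: rtree T by fact
  interpret B: group "BijGroup X" by (rule group_BijGroup)
  interpret F: subgroup F "BijGroup X" by fact
  have Bij: "f \<in> Bij X" if "f \<in> F" for f using F.mem_carrier[OF that] by (simp add: BijGroup_def)
  \<comment> \<open>\<open>?h a\<close> maps the colour of \<open>a\<close> back to the common
    representative \<open>r a\<close> and then to the colour of the reverse arc. For the reverse arc
    it is the inverse permutation, which is the cancellation that transport requires. It multiplies
    on the right in \<tau> because it must act on colours before the recolouring does.\<close>
  let ?h = "\<lambda>a. k (arc_rev T a) \<otimes>\<^bsub>BijGroup X\<^esub> inv\<^bsub>BijGroup X\<^esub> k a"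
  have h: "?h a \<in> F" if "a \<in> arcs T" for a using that by (intro F.m_closed F.m_inv_closed k) simp_all
  obtain v\<^sub>0 where v\<^sub>0: "v\<^sub>0 \<in> verts T" using T.verts_nonempty by blast
  obtain f where f: "f \<in> verts T \<rightarrow> F"
    "\<And>a. a \<in> arcs T \<Longrightarrow> f (head T a) = f (tail T a) \<otimes>\<^bsub>BijGroup X\<^esub> ?h a"
  proof (rule T.transport[where Q = F and \<tau> = "\<lambda>a q. q \<otimes>\<^bsub>BijGroup X\<^esub> ?h a"
        and q\<^sub>0 = "\<one>\<^bsub>BijGroup X\<^esub>"])
    fix a q assume a: "a \<in> arcs T" and q: "q \<in> F"
    have "k a \<in> carrier (BijGroup X)" "k (arc_rev T a) \<in> carrier (BijGroup X)"
      using k(1) a by (simp_all add: F.mem_carrier)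
    moreover from this have "inv\<^bsub>BijGroup X\<^esub> k a \<otimes>\<^bsub>BijGroup X\<^esub>
        (k a \<otimes>\<^bsub>BijGroup X\<^esub> inv\<^bsub>BijGroup X\<^esub> k (arc_rev T a)) = inv\<^bsub>BijGroup X\<^esub> k (arc_rev T a)"
      by (simp add: B.m_assoc[symmetric])
    ultimately have "?h a \<otimes>\<^bsub>BijGroup X\<^esub> ?h (arc_rev T a) = \<one>\<^bsub>BijGroup X\<^esub>"
      using a by (simp add: B.m_assoc)
    then show "(q \<otimes>\<^bsub>BijGroup X\<^esub> ?h a) \<otimes>\<^bsub>BijGroup X\<^esub> ?h (arc_rev T a) = q"
      using q h[OF a] h[of "arc_rev T a"] a by (simp add: B.m_assoc F.mem_carrier)
  qed (use v\<^sub>0 h in auto)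
  have f_in: "f v \<in> F" if "v \<in> verts T" for v using f(1) that by blast
  have rev: "f (head T (arc_rev T a)) (d (arc_rev T a)) = f (head T a) (d a)" if a: "a \<in> arcs T" for a
  proof -
    have "f (head T a) \<otimes>\<^bsub>BijGroup X\<^esub> k a = f (tail T a) \<otimes>\<^bsub>BijGroup X\<^esub> k (arc_rev T a)"
      using a k(1)[OF a] k(1)[of "arc_rev T a"] f_in[of "tail T a"]
      by (simp add: f(2) B.m_assoc F.mem_carrier)
    then have "(f (head T a) \<otimes>\<^bsub>BijGroup X\<^esub> k a) (r a)
        = (f (tail T a) \<otimes>\<^bsub>BijGroup X\<^esub> k (arc_rev T a)) (r (arc_rev T a))"
      using r(2)[OF a] by simp
    then show ?thesis
      using a r k[OF a] k[of "arc_rev T a"] by (simp add: BijGroup_mult_apply Bij f_in)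
  qed
  have "bij_betw (\<lambda>a. f (head T a) (d a)) (Star T v) X" if v: "v \<in> verts T" for v
  proof -
    have "bij_betw (f v) X X" using Bij[OF f_in[OF v]] by (simp add: Bij_def)
    then have "bij_betw (f v \<circ> d) (Star T v) X" using star_colouringD[OF star v] by (intro bij_betw_trans)
    then show ?thesis by (rule bij_betw_cong[THEN iffD1, rotated]) simp
  qed
  with rev have "legal_colouring X T (\<lambda>a. f (head T a) (d a))"
    unfolding legal_colouring_def by blast
  with f(1) show thesis by (rule that)
qed

section \<open>Automorphism groups\<close>

lemma rgraph_hom_inverse:
  assumes "rgraph G" "rgraph H" "rgraph_hom G H fV fA"
    and V: "\<And>w. w \<in> verts H \<Longrightarrow> gV w \<in> verts G" "\<And>v. v \<in> verts G \<Longrightarrow> gV (fV v) = v"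
    and A: "\<And>b. b \<in> arcs H \<Longrightarrow> gA b \<in> arcs G" "\<And>b. b \<in> arcs H \<Longrightarrow> fA (gA b) = b"
      "\<And>a. a \<in> arcs G \<Longrightarrow> gA (fA a) = a"
  shows "rgraph_hom H G gV gA"
proof -
  interpret G: rgraph G by fact
  interpret H: rgraph H by fact
  have f: "tail H (fA a) = fV (tail G a)" "head H (fA a) = fV (head G a)"
    "arc_rev H (fA a) = fA (arc_rev G a)" if "a \<in> arcs G" for a
    using assms(3) that unfolding rgraph_hom_def by auto
  have "tail G (gA b) = gV (tail H b) \<and> head G (gA b) = gV (head H b) \<and>
      arc_rev G (gA b) = gA (arc_rev H b)" if b: "b \<in> arcs H" for b
    using f[OF A(1)[OF b]] A(1)[OF b] by (simp add: A(2)[OF b] V(2) A(3))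
  then show ?thesis unfolding rgraph_hom_def using V(1) A(1) by blast
qed

lemma rgraph_autsD:
  assumes "g \<in> rgraph_auts G"
  shows "fst g \<in> Bij (verts G)" "snd g \<in> Bij (arcs G)" "rgraph_hom G G (fst g) (snd g)"
    "v \<in> verts G \<Longrightarrow> fst g v \<in> verts G" "a \<in> arcs G \<Longrightarrow> snd g a \<in> arcs G"
    "a \<in> arcs G \<Longrightarrow> tail G (snd g a) = fst g (tail G a)"
    "a \<in> arcs G \<Longrightarrow> head G (snd g a) = fst g (head G a)"
    "a \<in> arcs G \<Longrightarrow> arc_rev G (snd g a) = snd g (arc_rev G a)"
  using assms unfolding rgraph_auts_def rgraph_hom_def by auto

lemma rgraph_auts_eqI:
  assumes "g \<in> rgraph_auts G" "h \<in> rgraph_auts G"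
    and "\<And>v. v \<in> verts G \<Longrightarrow> fst g v = fst h v" "\<And>a. a \<in> arcs G \<Longrightarrow> snd g a = snd h a"
  shows "g = h"
  using rgraph_autsD(1,2)[OF assms(1)] rgraph_autsD(1,2)[OF assms(2)] assms(3,4)
  by (auto simp: prod_eq_iff Bij_def intro: extensionalityI)

lemma carrier_aut_group [simp]: "carrier (aut_group G) = rgraph_auts G"
  by (simp add: aut_group_def)

lemma mult_aut_group:
  "g \<in> rgraph_auts G \<Longrightarrow> h \<in> rgraph_auts G \<Longrightarrow>
   g \<otimes>\<^bsub>aut_group G\<^esub> h = (compose (verts G) (fst g) (fst h), compose (arcs G) (snd g) (snd h))"
  by (cases g; cases h) (simp add: aut_group_def BijGroup_def rgraph_auts_def DirProd_def)

lemma one_aut_group: "\<one>\<^bsub>aut_group G\<^esub> = (\<lambda>v\<in>verts G. v, \<lambda>a\<in>arcs G. a)"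
  by (simp add: aut_group_def BijGroup_def DirProd_def)

lemma group_aut_group:
  assumes "rgraph G"
  shows "group (aut_group G)"
proof -
  interpret G: rgraph G by fact
  let ?P = "BijGroup (verts G) \<times>\<times> BijGroup (arcs G)"
  interpret P: group ?P by (intro DirProd_group group_BijGroup)
  have "subgroup (rgraph_auts G) ?P"
  proof (rule P.subgroupI)
    show "rgraph_auts G \<subseteq> carrier ?P"
      by (auto simp: rgraph_auts_def BijGroup_def)
    have "(\<lambda>v\<in>verts G. v, \<lambda>a\<in>arcs G. a) \<in> rgraph_auts G"
      by (auto simp: rgraph_auts_def rgraph_hom_def id_Bij)
    then show "rgraph_auts G \<noteq> {}" by blast
    fix g assume g: "g \<in> rgraph_auts G"
    note gD = rgraph_autsD[OF g]
    have bij: "bij_betw (fst g) (verts G) (verts G)" "bij_betw (snd g) (arcs G) (arcs G)"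
      using gD(1,2) by (simp_all add: Bij_def)
    let ?V = "\<lambda>v\<in>verts G. inv_into (verts G) (fst g) v"
    let ?A = "\<lambda>a\<in>arcs G. inv_into (arcs G) (snd g) a"
    have "rgraph_hom G G ?V ?A"
      by (rule rgraph_hom_inverse[OF assms assms gD(3)])
        (use bij gD(4,5) in \<open>auto simp: bij_betw_inv_into_left bij_betw_inv_into_right
           Bij_inv_into_mem[OF gD(1)] Bij_inv_into_mem[OF gD(2)]\<close>)
    then have "(?V, ?A) \<in> rgraph_auts G"
      by (simp add: rgraph_auts_def restrict_inv_into_Bij gD(1,2) del: restrict_apply)
    moreover have "inv\<^bsub>?P\<^esub> g = (?V, ?A)"
      using inv_DirProd[OF group_BijGroup group_BijGroup, of "fst g" "verts G" "snd g" "arcs G"] gD(1,2)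
      by (simp add: inv_BijGroup) (simp add: BijGroup_def)
    ultimately show "inv\<^bsub>?P\<^esub> g \<in> rgraph_auts G" by simp
    fix h assume h: "h \<in> rgraph_auts G"
    have "g \<otimes>\<^bsub>?P\<^esub> h = (compose (verts G) (fst g) (fst h), compose (arcs G) (snd g) (snd h))"
      using mult_aut_group[OF g h] by (simp add: aut_group_def)
    moreover have "\<dots> \<in> rgraph_auts G"
      using gD rgraph_autsD[OF h]
      by (auto simp: rgraph_auts_def rgraph_hom_def compose_Bij compose_eq)
    ultimately show "g \<otimes>\<^bsub>?P\<^esub> h \<in> rgraph_auts G" by simp
  qed
  from P.subgroup_imp_group[OF this] show ?thesis by (simp add: aut_group_def)
qed

lemma aut_group_mult_apply:
  assumes "g \<in> rgraph_auts G" "h \<in> rgraph_auts G"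
  shows "v \<in> verts G \<Longrightarrow> fst (g \<otimes>\<^bsub>aut_group G\<^esub> h) v = fst g (fst h v)"
    and "a \<in> arcs G \<Longrightarrow> snd (g \<otimes>\<^bsub>aut_group G\<^esub> h) a = snd g (snd h a)"
  by (simp_all add: mult_aut_group[OF assms] compose_eq)

lemma aut_group_inv_apply:
  assumes "rgraph G" "g \<in> rgraph_auts G"
  shows "v \<in> verts G \<Longrightarrow> fst g (fst (inv\<^bsub>aut_group G\<^esub> g) v) = v"
    and "a \<in> arcs G \<Longrightarrow> snd g (snd (inv\<^bsub>aut_group G\<^esub> g) a) = a"
proof -
  interpret A: group "aut_group G" by (rule group_aut_group) fact
  have inv: "g \<otimes>\<^bsub>aut_group G\<^esub> inv\<^bsub>aut_group G\<^esub> g = \<one>\<^bsub>aut_group G\<^esub>"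
    using assms(2) by (intro A.r_inv) simp
  have "inv\<^bsub>aut_group G\<^esub> g \<in> rgraph_auts G"
    using A.inv_closed[of g] assms(2) by simp
  note mult_apply = aut_group_mult_apply[OF assms(2) this]
  show "fst g (fst (inv\<^bsub>aut_group G\<^esub> g) v) = v" if "v \<in> verts G"
    using mult_apply(1)[OF that] that unfolding inv by (simp add: one_aut_group)
  show "snd g (snd (inv\<^bsub>aut_group G\<^esub> g) a) = a" if "a \<in> arcs G"
    using mult_apply(2)[OF that] that unfolding inv by (simp add: one_aut_group)
qed

text \<open>Automorphisms are extensional, so the homomorphism property can be checked pointwise.
  \<open>L\<close> is to be a group that inherits the multiplication of \<open>aut_group G\<close>
  on a smaller carrier.\<close>

lemma hom_aut_groupI:
  assumes "carrier L \<subseteq> rgraph_auts G" "\<And>g h. mult L g h = mult (aut_group G) g h"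
  assumes "\<And>g. g \<in> carrier L \<Longrightarrow> \<rho> g \<in> rgraph_auts H"
    and "rgraph H" "\<And>g h. g \<in> carrier L \<Longrightarrow> h \<in> carrier L \<Longrightarrow> g \<otimes>\<^bsub>L\<^esub> h \<in> carrier L"
    and "\<And>g h v. g \<in> carrier L \<Longrightarrow> h \<in> carrier L \<Longrightarrow> v \<in> verts H \<Longrightarrow>
      fst (\<rho> (g \<otimes>\<^bsub>L\<^esub> h)) v = fst (\<rho> g) (fst (\<rho> h) v)"
    and "\<And>g h a. g \<in> carrier L \<Longrightarrow> h \<in> carrier L \<Longrightarrow> a \<in> arcs H \<Longrightarrow>
      snd (\<rho> (g \<otimes>\<^bsub>L\<^esub> h)) a = snd (\<rho> g) (snd (\<rho> h) a)"
  shows "\<rho> \<in> hom L (aut_group H)"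
proof (rule homI)
  interpret H: group "aut_group H" by (rule group_aut_group) fact
  fix g h assume gh: "g \<in> carrier L" "h \<in> carrier L"
  show "\<rho> (g \<otimes>\<^bsub>L\<^esub> h) = \<rho> g \<otimes>\<^bsub>aut_group H\<^esub> \<rho> h"
    using gh H.m_closed[of "\<rho> g" "\<rho> h"]
    by (intro rgraph_auts_eqI[where G = H]) (simp_all add: assms(3,5-7) aut_group_mult_apply)
qed (simp add: assms(3))

section \<open>Burger--Mozes groups of star colourings\<close>

text \<open>Pointwise on \<open>X\<close>, so that later computations with colours avoid restricted
  inverses and compositions in \<open>BijGroup\<close>.\<close>

lemma perm_inverse:
  assumes "subgroup F (BijGroup X)" "f \<in> F"
  shows "\<exists>f'\<in>F. \<forall>y\<in>X. f' (f y) = y"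
proof -
  interpret F: subgroup F "BijGroup X" by fact
  have f: "f \<in> Bij X" using F.mem_carrier[OF assms(2)] by (simp add: BijGroup_def)
  then have bij: "bij_betw f X X" by (simp add: Bij_def)
  have "(\<lambda>y\<in>X. inv_into X f y) \<in> F"
    using F.m_inv_closed[OF assms(2)] by (simp add: inv_BijGroup[OF f])
  then show ?thesis
    by (rule bexI[rotated]) (use bij_betwE[OF bij] in \<open>simp add: bij_betw_inv_into_left[OF bij]\<close>)
qed

lemma perm_comp:
  assumes "subgroup F (BijGroup X)" "f \<in> F" "g \<in> F"
  shows "\<exists>h\<in>F. \<forall>y\<in>X. h y = f (g y)"
proof -
  interpret F: subgroup F "BijGroup X" by fact
  have "f \<in> Bij X" "g \<in> Bij X"
    using assms(2,3)[THEN F.mem_carrier] by (simp_all add: BijGroup_def)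
  then show ?thesis
    by (intro bexI[OF _ F.m_closed[OF assms(2,3)]]) (simp add: BijGroup_mult_apply)
qed

lemma perm_closed: "\<lbrakk>subgroup F (BijGroup X); f \<in> F; y \<in> X\<rbrakk> \<Longrightarrow> f y \<in> X"
  using subgroup.mem_carrier[of F "BijGroup X" f] by (auto simp: BijGroup_def dest: Bij_imp_funcset)

lemma burger_mozes_group_auts: "g \<in> carrier (burger_mozes_group X F T d) \<Longrightarrow> g \<in> rgraph_auts T"
  by (simp add: burger_mozes_group_def)

lemma restrict_inv_into_mem_iff:
  assumes F: "subgroup F (BijGroup X)" and bij: "bij_betw c A X"
  shows "(\<lambda>z\<in>X. e (inv_into A c z)) \<in> F \<longleftrightarrow> (\<exists>h\<in>F. \<forall>a\<in>A. e a = h (c a))"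
    (is "?\<sigma> \<in> F \<longleftrightarrow> ?R")
proof
  assume "?\<sigma> \<in> F"
  moreover have "e a = ?\<sigma> (c a)" if "a \<in> A" for a
    using that bij_betwE[OF bij] by (simp add: bij_betw_inv_into_left[OF bij])
  ultimately show ?R by blast
next
  assume ?R
  then obtain h where h: "h \<in> F" "\<And>a. a \<in> A \<Longrightarrow> e a = h (c a)" by blast
  have "h \<in> extensional X"
    using subgroup.mem_carrier[OF F h(1)] by (simp add: BijGroup_def Bij_def)
  moreover have "h z = ?\<sigma> z" if z: "z \<in> X" for z
  proof -
    have "z \<in> c ` A" using bij z by (simp add: bij_betw_def)
    from h(2)[OF inv_into_into[OF this]] f_inv_into_f[OF this] z show ?thesis by simp
  qed
  moreover have "?\<sigma> \<in> extensional X" by (rule restrict_extensional)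
  ultimately have "h = ?\<sigma>" by (metis extensionalityI)
  then show "?\<sigma> \<in> F" using h(1) by simp
qed

lemma mem_burger_mozes_group:
  assumes "subgroup F (BijGroup X)" "star_colouring X T d"
  shows "g \<in> carrier (burger_mozes_group X F T d) \<longleftrightarrow>
    g \<in> rgraph_auts T \<and> (\<forall>v\<in>verts T. \<exists>h\<in>F. \<forall>a\<in>Star T v. d (snd g a) = h (d a))"
  using restrict_inv_into_mem_iff[OF assms(1) star_colouringD[OF assms(2)],
      where e = "\<lambda>a. d (snd g a)"]
  unfolding burger_mozes_group_def by simp

lemma mult_burger_mozes_group [simp]:
  "mult (burger_mozes_group X F T d) = mult (aut_group T)"
  by (simp add: burger_mozes_group_def)

text \<open>Local permutations form a cocycle: that of a product \<open>g g'\<close> at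
  \<open>v\<close> is that of \<open>g\<close> at \<open>g' v\<close> after that of
  \<open>g'\<close> at \<open>v\<close>, and that of the inverse of \<open>g\<close> at
  \<open>v\<close> inverts that of \<open>g\<close> at the preimage of \<open>v\<close>. Reversal of
  arcs does not enter.\<close>

lemma subgroup_burger_mozes_group:
  assumes "rgraph T" and F: "subgroup F (BijGroup X)"
    and star: "star_colouring X T d"
  shows "subgroup (carrier (burger_mozes_group X F T d)) (aut_group T)"
proof -
  interpret T: rgraph T by fact
  interpret A: group "aut_group T" by (rule group_aut_group) fact
  interpret F: subgroup F "BijGroup X" by fact
  note mem = mem_burger_mozes_group[OF F star]
  have d: "d a \<in> X" if "a \<in> arcs T" for a
    using T.star_colouring_in[OF star that] .
  show ?thesis
  proof (rule A.subgroupI)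
    show "carrier (burger_mozes_group X F T d) \<subseteq> carrier (aut_group T)"
      using burger_mozes_group_auts by fastforce
    have "\<one>\<^bsub>aut_group T\<^esub> \<in> carrier (burger_mozes_group X F T d)"
      unfolding mem
    proof (intro conjI ballI)
      show "\<one>\<^bsub>aut_group T\<^esub> \<in> rgraph_auts T" using A.one_closed by simp
      fix v
      show "\<exists>h\<in>F. \<forall>a\<in>Star T v. d (snd \<one>\<^bsub>aut_group T\<^esub> a) = h (d a)"
        using d by (intro bexI[OF _ F.one_closed]) (simp add: one_aut_group BijGroup_def)
    qed
    then show "carrier (burger_mozes_group X F T d) \<noteq> {}" by blast
    fix g assume "g \<in> carrier (burger_mozes_group X F T d)"
    then have g: "g \<in> rgraph_auts T" "\<And>v. v \<in> verts T \<Longrightarrow> \<exists>h\<in>F. \<forall>a\<in>Star T v. d (snd g a) = h (d a)"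
      unfolding mem by blast+
    let ?i = "inv\<^bsub>aut_group T\<^esub> g"
    have i: "?i \<in> rgraph_auts T" using A.inv_closed[of g] g(1) by simp
    show "?i \<in> carrier (burger_mozes_group X F T d)"
      unfolding mem
    proof (intro conjI ballI i)
      fix v assume v: "v \<in> verts T"
      obtain h where h: "h \<in> F" "\<forall>a\<in>Star T (fst ?i v). d (snd g a) = h (d a)"
        using g(2)[OF rgraph_autsD(4)[OF i v]] by blast
      obtain h' where h': "h' \<in> F" "\<forall>y\<in>X. h' (h y) = y"
        using perm_inverse[OF F h(1)] by blast
      have "d (snd ?i a) = h' (d a)" if "a \<in> Star T v" for a
      proof -
        have a: "a \<in> arcs T" "head T a = v" using that by simp_all
        have "snd ?i a \<in> Star T (fst ?i v)" using rgraph_autsD(5,7)[OF i] a by simp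
        from h(2)[rule_format, OF this] have "d a = h (d (snd ?i a))"
          by (simp only: aut_group_inv_apply(2)[OF assms(1) g(1) a(1)])
        then show ?thesis using h'(2)[rule_format, OF d[OF rgraph_autsD(5)[OF i a(1)]]] by simp
      qed
      then show "\<exists>h\<in>F. \<forall>a\<in>Star T v. d (snd ?i a) = h (d a)" using h'(1) by blast
    qed
    fix g' assume "g' \<in> carrier (burger_mozes_group X F T d)"
    then have g': "g' \<in> rgraph_auts T" "\<And>v. v \<in> verts T \<Longrightarrow> \<exists>h\<in>F. \<forall>a\<in>Star T v. d (snd g' a) = h (d a)"
      unfolding mem by blast+
    show "g \<otimes>\<^bsub>aut_group T\<^esub> g' \<in> carrier (burger_mozes_group X F T d)"
      unfolding mem
    proof (intro conjI ballI)
      show "g \<otimes>\<^bsub>aut_group T\<^esub> g' \<in> rgraph_auts T" using A.m_closed[of g g'] g(1) g'(1) by simp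
      fix v assume v: "v \<in> verts T"
      obtain h' where h': "h' \<in> F" "\<forall>a\<in>Star T v. d (snd g' a) = h' (d a)"
        using g'(2)[OF v] by blast
      obtain h where h: "h \<in> F" "\<forall>a\<in>Star T (fst g' v). d (snd g a) = h (d a)"
        using g(2)[OF rgraph_autsD(4)[OF g'(1) v]] by blast
      obtain k where k: "k \<in> F" "\<forall>y\<in>X. k y = h (h' y)"
        using perm_comp[OF F h(1) h'(1)] by blast
      have "d (snd (g \<otimes>\<^bsub>aut_group T\<^esub> g') a) = k (d a)" if "a \<in> Star T v" for a
      proof -
        have a: "a \<in> arcs T" "head T a = v" using that by simp_all
        have "snd g' a \<in> Star T (fst g' v)" using rgraph_autsD(5,7)[OF g'(1)] a by simp
        from h(2)[rule_format, OF this] h'(2)[rule_format, OF that] show ?thesis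
          by (simp only: aut_group_mult_apply(2)[OF g(1) g'(1) a(1)] k(2)[rule_format, OF d[OF a(1)]])
      qed
      then show "\<exists>h\<in>F. \<forall>a\<in>Star T v. d (snd (g \<otimes>\<^bsub>aut_group T\<^esub> g') a) = h (d a)"
        using k(1) by blast
    qed
  qed
qed

section \<open>Conjugation by an isomorphism that recolours stars\<close>

definition conj_auts ::
    "('w, 'b) pre_rgraph \<Rightarrow> ('v \<Rightarrow> 'w) \<times> ('a \<Rightarrow> 'b) \<Rightarrow> ('w \<Rightarrow> 'v) \<times> ('b \<Rightarrow> 'a) \<Rightarrow>
     ('v \<Rightarrow> 'v) \<times> ('a \<Rightarrow> 'a) \<Rightarrow> ('w \<Rightarrow> 'w) \<times> ('b \<Rightarrow> 'b)" where
  "conj_auts H \<Phi> \<Psi> g =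
     (\<lambda>w\<in>verts H. fst \<Phi> (fst g (fst \<Psi> w)), \<lambda>b\<in>arcs H. snd \<Phi> (snd g (snd \<Psi> b)))"

lemma inverse_homsD:
  assumes "inverse_homs G H \<Phi> \<Psi>"
  shows "v \<in> verts G \<Longrightarrow> fst \<Phi> v \<in> verts H" "a \<in> arcs G \<Longrightarrow> snd \<Phi> a \<in> arcs H"
    "v \<in> verts G \<Longrightarrow> fst \<Psi> (fst \<Phi> v) = v" "a \<in> arcs G \<Longrightarrow> snd \<Psi> (snd \<Phi> a) = a"
    "a \<in> arcs G \<Longrightarrow> tail H (snd \<Phi> a) = fst \<Phi> (tail G a)"
    "a \<in> arcs G \<Longrightarrow> head H (snd \<Phi> a) = fst \<Phi> (head G a)"
    "a \<in> arcs G \<Longrightarrow> arc_rev H (snd \<Phi> a) = snd \<Phi> (arc_rev G a)"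
  using assms unfolding inverse_homs_def rgraph_hom_def by auto

lemma conj_auts_in_rgraph_auts:
  assumes "rgraph H" "inverse_homs G H \<Phi> \<Psi>" "g \<in> rgraph_auts G"
  shows "conj_auts H \<Phi> \<Psi> g \<in> rgraph_auts H"
proof -
  interpret H: rgraph H by fact
  note \<Phi> = inverse_homsD[OF assms(2)]
  note \<Psi> = inverse_homsD[OF inverse_homs_sym[OF assms(2)]]
  note g = rgraph_autsD[OF assms(3)]
  have "bij_betw (fst \<Phi>) (verts G) (verts H)" "bij_betw (snd \<Phi>) (arcs G) (arcs H)"
    using inverse_homs_iso[OF assms(2)] by (simp_all add: rgraph_iso_def)
  moreover have "bij_betw (fst \<Psi>) (verts H) (verts G)" "bij_betw (snd \<Psi>) (arcs H) (arcs G)"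
    using inverse_homs_iso[OF inverse_homs_sym[OF assms(2)]]
    by (simp_all add: rgraph_iso_def)
  moreover have "bij_betw (fst g) (verts G) (verts G)" "bij_betw (snd g) (arcs G) (arcs G)"
    using g(1,2) by (simp_all add: Bij_def)
  ultimately have "bij_betw (fst \<Phi> \<circ> (fst g \<circ> fst \<Psi>)) (verts H) (verts H)"
    "bij_betw (snd \<Phi> \<circ> (snd g \<circ> snd \<Psi>)) (arcs H) (arcs H)"
    by (simp_all only: bij_betw_trans[OF bij_betw_trans])
  then have "fst (conj_auts H \<Phi> \<Psi> g) \<in> Bij (verts H)" "snd (conj_auts H \<Phi> \<Psi> g) \<in> Bij (arcs H)"
    by (simp_all add: Bij_def conj_auts_def o_def)
  moreover have "rgraph_hom H H (fst (conj_auts H \<Phi> \<Psi> g)) (snd (conj_auts H \<Phi> \<Psi> g))"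
    by (auto simp: rgraph_hom_def conj_auts_def \<Phi> \<Psi> g)
  ultimately show ?thesis by (auto simp: rgraph_auts_def split_beta)
qed

lemma conj_auts_conj_auts:
  assumes "inverse_homs G H \<Phi> \<Psi>" "g \<in> rgraph_auts G" "rgraph G" "rgraph H"
  shows "conj_auts G \<Psi> \<Phi> (conj_auts H \<Phi> \<Psi> g) = g"
proof (rule rgraph_auts_eqI)
  show "conj_auts G \<Psi> \<Phi> (conj_auts H \<Phi> \<Psi> g) \<in> rgraph_auts G"
    by (intro conj_auts_in_rgraph_auts[OF assms(3) inverse_homs_sym[OF assms(1)]]
        conj_auts_in_rgraph_auts[OF assms(4,1,2)])
  show "g \<in> rgraph_auts G" by fact
qed (simp_all add: conj_auts_def inverse_homsD[OF assms(1)] rgraph_autsD[OF assms(2)])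

text \<open>For \<open>v\<close> = \<Psi> \<open>w\<close>, the local permutation of the conjugate
  at \<open>w\<close> is \<open>f (g v) h (f v)^-1\<close>, where \<open>h\<close> is that of
  \<open>g\<close> at \<open>v\<close>; all three factors lie in \<open>F\<close>. This is where
  recolouring by \<open>F\<close> preserves the group.\<close>

lemma conj_auts_in_burger_mozes_group:
  assumes G: "rgraph G" and H: "rgraph H" and F: "subgroup F (BijGroup X)"
    and inv: "inverse_homs G H \<Phi> \<Psi>"
    and starG: "star_colouring X G d"
    and starH: "star_colouring X H c"
    and f: "\<And>v. v \<in> verts G \<Longrightarrow> f v \<in> F" "\<And>a. a \<in> arcs G \<Longrightarrow> c (snd \<Phi> a) = f (head G a) (d a)"
    and g: "g \<in> carrier (burger_mozes_group X F G d)"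
  shows "conj_auts H \<Phi> \<Psi> g \<in> carrier (burger_mozes_group X F H c)"
proof -
  interpret G: rgraph G by fact
  interpret H: rgraph H by fact
  note \<Phi> = inverse_homsD[OF inv]
  note \<Psi> = inverse_homsD[OF inverse_homs_sym[OF inv]]
  have gD: "g \<in> rgraph_auts G" "\<And>v. v \<in> verts G \<Longrightarrow> \<exists>h\<in>F. \<forall>a\<in>Star G v. d (snd g a) = h (d a)"
    using g unfolding mem_burger_mozes_group[OF F starG] by blast+
  note gA = rgraph_autsD[OF gD(1)]
  have d: "d a \<in> X" if "a \<in> arcs G" for a
    using G.star_colouring_in[OF starG that] .
  have "\<exists>h\<in>F. \<forall>b\<in>Star H w. c (snd (conj_auts H \<Phi> \<Psi> g) b) = h (c b)" if w: "w \<in> verts H" for w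
  proof -
    let ?v = "fst \<Psi> w"
    have v: "?v \<in> verts G" by (rule \<Psi>(1)[OF w])
    obtain h where h: "h \<in> F" "\<forall>a\<in>Star G ?v. d (snd g a) = h (d a)" using gD(2)[OF v] by blast
    obtain f' where f': "f' \<in> F" "\<forall>y\<in>X. f' (f ?v y) = y"
      using perm_inverse[OF F f(1)[OF v]] by blast
    obtain k\<^sub>0 where k\<^sub>0: "k\<^sub>0 \<in> F" "\<forall>y\<in>X. k\<^sub>0 y = h (f' y)"
      using perm_comp[OF F h(1) f'(1)] by blast
    obtain k where k: "k \<in> F" "\<forall>y\<in>X. k y = f (fst g ?v) (k\<^sub>0 y)"
      using perm_comp[OF F f(1)[OF gA(4)[OF v]] k\<^sub>0(1)] by blast
    have "c (snd (conj_auts H \<Phi> \<Psi> g) b) = k (c b)" if "b \<in> Star H w" for b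
    proof -
      have b: "b \<in> arcs H" "head H b = w" using that by simp_all
      let ?a = "snd \<Psi> b"
      have a: "?a \<in> arcs G" "head G ?a = ?v" using \<Psi>(2,6)[OF b(1)] b(2) by simp_all
      have cb: "c b = f ?v (d ?a)" using f(2)[OF a(1)] \<Psi>(4)[OF b(1)] a(2) by simp
      have "c (snd \<Phi> (snd g ?a)) = f (fst g ?v) (d (snd g ?a))"
        using f(2)[OF gA(5)[OF a(1)]] gA(7)[OF a(1)] a(2) by simp
      also have "\<dots> = k (c b)"
        using h(2) a cb d[OF a(1)] by (simp add: k k\<^sub>0 f' perm_closed[OF F f(1)[OF v]])
      finally show ?thesis using b(1) by (simp add: conj_auts_def)
    qed
    then show ?thesis using k(1) by blast
  qed
  then show ?thesis
    using conj_auts_in_rgraph_auts[OF H inv gD(1)]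
    by (simp add: mem_burger_mozes_group[OF F starH])
qed

text \<open>The hypotheses are symmetric: exchanging \<Phi> with \<Psi> and inverting each
  \<open>f v\<close> describes the recolouring from \<open>H\<close> back to \<open>G\<close>, so
  the inverse map is covered by the same membership lemma.\<close>

lemma conj_auts_iso:
  assumes G: "rgraph G" and H: "rgraph H" and F: "subgroup F (BijGroup X)"
    and inv: "inverse_homs G H \<Phi> \<Psi>"
    and starG: "star_colouring X G d"
    and starH: "star_colouring X H c"
    and f: "\<And>v. v \<in> verts G \<Longrightarrow> f v \<in> F" "\<And>a. a \<in> arcs G \<Longrightarrow> c (snd \<Phi> a) = f (head G a) (d a)"
  shows "conj_auts H \<Phi> \<Psi> \<in> iso (burger_mozes_group X F G d) (burger_mozes_group X F H c)"
proof -
  interpret G: rgraph G by fact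
  interpret H: rgraph H by fact
  let ?BG = "carrier (burger_mozes_group X F G d)" and ?BH = "carrier (burger_mozes_group X F H c)"
  note inv' = inverse_homs_sym[OF inv]
  note \<Phi> = inverse_homsD[OF inv]
  note \<Psi> = inverse_homsD[OF inv']
  have fwd: "conj_auts H \<Phi> \<Psi> g \<in> ?BH" if "g \<in> ?BG" for g
    using assms that by (rule conj_auts_in_burger_mozes_group)
  have d: "d a \<in> X" if "a \<in> arcs G" for a
    using G.star_colouring_in[OF starG that] .
  have "\<forall>v\<in>verts G. \<exists>g. g \<in> F \<and> (\<forall>y\<in>X. g (f v y) = y)"
  proof
    fix v assume "v \<in> verts G"
    from perm_inverse[OF F f(1)[OF this]] show "\<exists>g. g \<in> F \<and> (\<forall>y\<in>X. g (f v y) = y)" by blast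
  qed
  from bchoice[OF this] obtain f' where f': "\<And>v. v \<in> verts G \<Longrightarrow> f' v \<in> F"
    "\<And>v y. v \<in> verts G \<Longrightarrow> y \<in> X \<Longrightarrow> f' v (f v y) = y"
    by blast
  have bwd: "conj_auts G \<Psi> \<Phi> g \<in> ?BG" if "g \<in> ?BH" for g
  proof (rule conj_auts_in_burger_mozes_group[OF H G F inv' starH starG _ _ that])
    show "f' (fst \<Psi> w) \<in> F" if "w \<in> verts H" for w using f'(1) \<Psi>(1) that by blast
    show "d (snd \<Psi> b) = f' (fst \<Psi> (head H b)) (c b)" if "b \<in> arcs H" for b
      using f(2)[OF \<Psi>(2)[OF that]] \<Psi>(4,6)[OF that] that f'(2) d \<Psi>(1,2) by simp
  qed
  have auts: "?BG \<subseteq> rgraph_auts G" "?BH \<subseteq> rgraph_auts H"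
    using burger_mozes_group_auts by blast+
  have "bij_betw (conj_auts H \<Phi> \<Psi>) ?BG ?BH"
    using conj_auts_conj_auts[OF inv _ G H] conj_auts_conj_auts[OF inv' _ H G] fwd bwd auts
    by (intro bij_betw_byWitness[where f' = "conj_auts G \<Psi> \<Phi>"]) auto
  \<comment> \<open>The product is that of the full automorphism group, so multiplicativity is
    proved there and the codomain is cut down by \<open>fwd\<close> afterwards.\<close>
  moreover have "conj_auts H \<Phi> \<Psi> \<in> hom (burger_mozes_group X F G d) (aut_group H)"
  proof (rule hom_aut_groupI[OF auts(1) _ _ H])
    interpret B: subgroup ?BG "aut_group G" by (rule subgroup_burger_mozes_group[OF G F starG])
    fix g h assume gh: "g \<in> ?BG" "h \<in> ?BG"
    then have gh': "g \<in> rgraph_auts G" "h \<in> rgraph_auts G" using auts by auto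
    show "g \<otimes>\<^bsub>burger_mozes_group X F G d\<^esub> h \<in> ?BG"
      using B.m_closed[OF gh] by simp
    show "fst (conj_auts H \<Phi> \<Psi> (g \<otimes>\<^bsub>burger_mozes_group X F G d\<^esub> h)) w =
        fst (conj_auts H \<Phi> \<Psi> g) (fst (conj_auts H \<Phi> \<Psi> h) w)" if "w \<in> verts H" for w
      using that rgraph_autsD(4)[OF gh'(2)]
      by (simp add: conj_auts_def aut_group_mult_apply[OF gh'] \<Phi> \<Psi>)
    show "snd (conj_auts H \<Phi> \<Psi> (g \<otimes>\<^bsub>burger_mozes_group X F G d\<^esub> h)) b =
        snd (conj_auts H \<Phi> \<Psi> g) (snd (conj_auts H \<Phi> \<Psi> h) b)" if "b \<in> arcs H" for b
      using that rgraph_autsD(5)[OF gh'(2)]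
      by (simp add: conj_auts_def aut_group_mult_apply[OF gh'] \<Phi> \<Psi>)
  qed (use fwd auts in auto)
  ultimately show ?thesis using fwd by (auto simp: iso_def hom_def)
qed

section \<open>The action of the universal group on the associated tree\<close>

lemma image_equiv_class:
  assumes "equiv A R" "bij_betw g A A"
    and pres: "\<And>u w. u \<in> A \<Longrightarrow> w \<in> A \<Longrightarrow> (g u, g w) \<in> R \<longleftrightarrow> (u, w) \<in> R" and u: "u \<in> A"
  shows "g ` (R `` {u}) = R `` {g u}"
proof
  have sub: "R \<subseteq> A \<times> A" using assms(1) by (simp add: equiv_type)
  then show "g ` (R `` {u}) \<subseteq> R `` {g u}" using pres[OF u] by blast
  show "R `` {g u} \<subseteq> g ` (R `` {u})"
  proof
    fix w assume w: "w \<in> R `` {g u}"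
    then have "w \<in> A" using sub by blast
    then obtain w' where w': "w' \<in> A" "w = g w'" using assms(2) by (auto simp: bij_betw_def)
    then have "(u, w') \<in> R" using w pres[OF u w'(1)] by blast
    then show "w \<in> g ` (R `` {u})" using w'(2) by blast
  qed
qed

lemma image_quotient_Bij:
  assumes "equiv A R" "bij_betw g A A"
    and pres: "\<And>u w. u \<in> A \<Longrightarrow> w \<in> A \<Longrightarrow> (g u, g w) \<in> R \<longleftrightarrow> (u, w) \<in> R"
  shows "(\<lambda>C\<in>A // R. g ` C) \<in> Bij (A // R)"
proof -
  have img: "g ` (R `` {u}) = R `` {g u}" if "u \<in> A" for u
    by (rule image_equiv_class[OF assms(1,2)]) (simp_all add: pres that)
  have g: "g u \<in> A" if "u \<in> A" for u using bij_betwE[OF assms(2)] that by blast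
  have surj: "\<exists>u\<in>A. g u = w" if "w \<in> A" for w
    using bij_betw_imp_surj_on[OF assms(2)] that by (metis imageE)
  have sub: "C \<subseteq> A" if "C \<in> A // R" for C
    using that equiv_type[OF assms(1)] by (auto simp: quotient_def)
  have "inj_on ((`) g) (A // R)"
    using inj_on_image_eq_iff[OF bij_betw_imp_inj_on[OF assms(2)]] sub by (simp add: inj_on_def)
  moreover have "(`) g ` (A // R) = A // R"
  proof
    show "(`) g ` (A // R) \<subseteq> A // R" by (auto simp: img quotientI g elim!: quotientE)
    show "A // R \<subseteq> (`) g ` (A // R)"
    proof
      fix C assume "C \<in> A // R"
      then obtain w where w: "w \<in> A" "C = R `` {w}" by (rule quotientE)
      then obtain u where "u \<in> A" "g u = w" using surj by blast
      then have "R `` {u} \<in> A // R" "C = g ` (R `` {u})" using w img by (simp_all add: quotientI)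
      then show "C \<in> (`) g ` (A // R)" by blast
    qed
  qed
  ultimately have "bij_betw ((`) g) (A // R) (A // R)" by (simp add: bij_betw_def)
  then show ?thesis by (simp add: Bij_def)
qed

lemma (in group_hom) subgroup_vimage:
  assumes "subgroup K H"
  shows "subgroup {g \<in> carrier G. h g \<in> K} G"
proof (rule G.subgroupI)
  interpret K: subgroup K H by fact
  show "{g \<in> carrier G. h g \<in> K} \<noteq> {}"
    using G.one_closed K.one_closed hom_one by (metis (mono_tags, lifting) empty_iff mem_Collect_eq)
  show "inv a \<in> {g \<in> carrier G. h g \<in> K}" if "a \<in> {g \<in> carrier G. h g \<in> K}" for a
    using that by (simp add: hom_inv)
  show "a \<otimes> b \<in> {g \<in> carrier G. h g \<in> K}"
    if "a \<in> {g \<in> carrier G. h g \<in> K}" "b \<in> {g \<in> carrier G. h g \<in> K}" for a b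
    using that by simp
qed blast

text \<open>Exactly the conditions of \<open>universal_group\<close> that make the induced action on
  the associated tree well defined; the conditions on projections and local permutations are imposed
  separately.\<close>

definition srel_auts ::
    "('s, 'e, 'v, 'a, 'x, 'y) pre_scaffolding \<Rightarrow> (('s \<Rightarrow> 's) \<times> ('e \<Rightarrow> 'e)) set" where
  "srel_auts S = {g \<in> rgraph_auts (sgraph S).
     \<forall>u\<in>verts (sgraph S). \<forall>w\<in>verts (sgraph S).
       (fst g u, fst g w) \<in> srel S \<longleftrightarrow> (u, w) \<in> srel S}"

section \<open>The quotient tree and the action induced on it\<close>

context scaffolding
begin

sublocale \<Sigma>: rgraph "sgraph S"
  by (rule sgraph_rgraph)

sublocale tree: rtree "assoc_tree S"
  by (rule assoc_tree_rtree)

abbreviation arel :: "'e rel" where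
  "arel \<equiv> arc_relation (sgraph S) (srel S)"

lemma arel_equiv: "equiv (arcs (sgraph S)) arel"
proof (rule equivI)
  have equiv_srel: "refl_on (verts (sgraph S)) (srel S)" "sym (srel S)" "trans (srel S)"
    using srel_equiv by (simp_all add: equiv_def)
  show "refl_on (arcs (sgraph S)) arel"
    using equiv_srel(1) by (simp add: refl_on_def arc_relation_def)
  show "sym arel"
    using equiv_srel(2) by (simp add: sym_on_def arc_relation_def)
  show "trans arel"
    using equiv_srel(3) unfolding trans_on_def arc_relation_def by blast
  show "arel \<subseteq> arcs (sgraph S) \<times> arcs (sgraph S)"
    by (auto simp: arc_relation_def)
qed

lemma srel_class_eq: "(u, w) \<in> srel S \<Longrightarrow> srel S `` {u} = srel S `` {w}"
  by (rule equiv_class_eq[OF srel_equiv])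

lemma verts_assoc_tree: "verts (assoc_tree S) = verts (sgraph S) // srel S"
  by (simp add: assoc_tree_def quotient_rgraph_def)

lemma arcs_assoc_tree: "arcs (assoc_tree S) = arcs (sgraph S) // arel"
  by (simp add: assoc_tree_def quotient_rgraph_def)

text \<open>The quotient takes as tail or head of an arc class the union of the classes of the ends
  of its members. As these ends are related, the union is a single class.\<close>

lemma Image_srel_image_class:
  assumes "b \<in> arcs (sgraph S)" and "\<And>b'. (b, b') \<in> arel \<Longrightarrow> (f b, f b') \<in> srel S"
  shows "srel S `` (f ` (arel `` {b})) = srel S `` {f b}"
proof -
  have b: "b \<in> arel `` {b}" by (rule equiv_class_self[OF arel_equiv assms(1)])
  have "srel S `` (f ` (arel `` {b})) = (\<Union>b'\<in>arel `` {b}. srel S `` {f b'})" by blast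
  also have "\<dots> = (\<Union>b'\<in>arel `` {b}. srel S `` {f b})"
    by (intro SUP_cong[OF refl] srel_class_eq[OF assms(2), symmetric]) simp
  also have "\<dots> = srel S `` {f b}" using b by blast
  finally show ?thesis .
qed

lemma assoc_tree_arc:
  assumes b: "b \<in> arcs (sgraph S)"
  shows "arel `` {b} \<in> arcs (assoc_tree S)"
    "tail (assoc_tree S) (arel `` {b}) = srel S `` {tail (sgraph S) b}"
    "head (assoc_tree S) (arel `` {b}) = srel S `` {head (sgraph S) b}"
    "arc_rev (assoc_tree S) (arel `` {b}) = arel `` {arc_rev (sgraph S) b}"
proof -
  show "arel `` {b} \<in> arcs (assoc_tree S)" using b by (simp add: arcs_assoc_tree quotientI)
  show "tail (assoc_tree S) (arel `` {b}) = srel S `` {tail (sgraph S) b}"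
    unfolding assoc_tree_def quotient_rgraph_def pre_digraph.simps
    by (rule Image_srel_image_class[OF b]) (simp add: arc_relation_def)
  show "head (assoc_tree S) (arel `` {b}) = srel S `` {head (sgraph S) b}"
    unfolding assoc_tree_def quotient_rgraph_def pre_digraph.simps
    by (rule Image_srel_image_class[OF b]) (simp add: arc_relation_def)
  have "bij_betw (arc_rev (sgraph S)) (arcs (sgraph S)) (arcs (sgraph S))"
    by (rule bij_betw_byWitness[where f' = "arc_rev (sgraph S)"]) auto
  then have "arc_rev (sgraph S) ` (arel `` {b}) = arel `` {arc_rev (sgraph S) b}"
    by (rule image_equiv_class[OF arel_equiv]) (auto simp: arc_relation_def b)
  then show "arc_rev (assoc_tree S) (arel `` {b}) = arel `` {arc_rev (sgraph S) b}"
    by (simp add: assoc_tree_def quotient_rgraph_def)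
qed

lemma srel_autsD:
  assumes "g \<in> srel_auts S"
  shows "g \<in> rgraph_auts (sgraph S)"
    "u \<in> verts (sgraph S) \<Longrightarrow> w \<in> verts (sgraph S) \<Longrightarrow>
      (fst g u, fst g w) \<in> srel S \<longleftrightarrow> (u, w) \<in> srel S"
    "b \<in> arcs (sgraph S) \<Longrightarrow> b' \<in> arcs (sgraph S) \<Longrightarrow>
      (snd g b, snd g b') \<in> arel \<longleftrightarrow> (b, b') \<in> arel"
proof -
  show g: "g \<in> rgraph_auts (sgraph S)" and
    pres: "u \<in> verts (sgraph S) \<Longrightarrow> w \<in> verts (sgraph S) \<Longrightarrow>
      (fst g u, fst g w) \<in> srel S \<longleftrightarrow> (u, w) \<in> srel S" for u w
    using assms by (simp_all add: srel_auts_def)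
  show "b \<in> arcs (sgraph S) \<Longrightarrow> b' \<in> arcs (sgraph S) \<Longrightarrow>
      (snd g b, snd g b') \<in> arel \<longleftrightarrow> (b, b') \<in> arel"
    by (simp add: arc_relation_def rgraph_autsD[OF g] pres)
qed

lemma srel_auts_bij:
  assumes "g \<in> srel_auts S"
  shows "bij_betw (fst g) (verts (sgraph S)) (verts (sgraph S))"
    and "bij_betw (snd g) (arcs (sgraph S)) (arcs (sgraph S))"
  using rgraph_autsD(1,2)[OF srel_autsD(1)[OF assms]] by (simp_all add: Bij_def)

lemma srel_auts_image:
  assumes "g \<in> srel_auts S"
  shows "u \<in> verts (sgraph S) \<Longrightarrow> fst g ` (srel S `` {u}) = srel S `` {fst g u}"
    and "b \<in> arcs (sgraph S) \<Longrightarrow> snd g ` (arel `` {b}) = arel `` {snd g b}"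
  using image_equiv_class[OF srel_equiv srel_auts_bij(1)[OF assms] srel_autsD(2)[OF assms]]
    image_equiv_class[OF arel_equiv srel_auts_bij(2)[OF assms] srel_autsD(3)[OF assms]]
  by simp_all

lemma assoc_tree_action_in_rgraph_auts:
  assumes g: "g \<in> srel_auts S"
  shows "assoc_tree_action S g \<in> rgraph_auts (assoc_tree S)"
proof -
  note gD = rgraph_autsD[OF srel_autsD(1)[OF g]] and img = srel_auts_image[OF g]
  have V: "fst (assoc_tree_action S g) \<in> Bij (verts (assoc_tree S))"
    and A: "snd (assoc_tree_action S g) \<in> Bij (arcs (assoc_tree S))"
    using image_quotient_Bij[OF srel_equiv srel_auts_bij(1)[OF g] srel_autsD(2)[OF g]]
      image_quotient_Bij[OF arel_equiv srel_auts_bij(2)[OF g] srel_autsD(3)[OF g]]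
    by (simp_all add: assoc_tree_action_def verts_assoc_tree arcs_assoc_tree)
  have "tail (assoc_tree S) (snd (assoc_tree_action S g) D) =
        fst (assoc_tree_action S g) (tail (assoc_tree S) D) \<and>
      head (assoc_tree S) (snd (assoc_tree_action S g) D) =
        fst (assoc_tree_action S g) (head (assoc_tree S) D) \<and>
      arc_rev (assoc_tree S) (snd (assoc_tree_action S g) D) =
        snd (assoc_tree_action S g) (arc_rev (assoc_tree S) D)"
    if D: "D \<in> arcs (assoc_tree S)" for D
  proof -
    obtain b where b: "b \<in> arcs (sgraph S)" "D = arel `` {b}"
      using D unfolding arcs_assoc_tree by (rule quotientE)
    have "srel S `` {tail (sgraph S) b} \<in> verts (assoc_tree S)"
      "srel S `` {head (sgraph S) b} \<in> verts (assoc_tree S)"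
      using b(1) by (simp_all add: verts_assoc_tree quotientI)
    moreover have "arel `` {arc_rev (sgraph S) b} \<in> arcs (assoc_tree S)"
      using b(1) by (intro assoc_tree_arc(1)) simp
    ultimately show ?thesis
      using b D gD(5-8) by (simp add: assoc_tree_action_def assoc_tree_arc img)
  qed
  then have "rgraph_hom (assoc_tree S) (assoc_tree S)
      (fst (assoc_tree_action S g)) (snd (assoc_tree_action S g))"
    unfolding rgraph_hom_def using Bij_imp_funcset[OF V] Bij_imp_funcset[OF A] by blast
  then show ?thesis using V A by (simp add: rgraph_auts_def split_beta)
qed

lemma assoc_tree_class_subset:
  "C \<in> verts (assoc_tree S) \<Longrightarrow> C \<subseteq> verts (sgraph S)"
  "D \<in> arcs (assoc_tree S) \<Longrightarrow> D \<subseteq> arcs (sgraph S)"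
  using equiv_type[OF srel_equiv] equiv_type[OF arel_equiv]
  by (auto simp: verts_assoc_tree arcs_assoc_tree quotient_def)

lemma subgroup_srel_auts: "subgroup (srel_auts S) (aut_group (sgraph S))"
proof -
  interpret A: group "aut_group (sgraph S)" by (rule group_aut_group[OF sgraph_rgraph])
  show ?thesis
  proof (rule A.subgroupI)
    show "srel_auts S \<subseteq> carrier (aut_group (sgraph S))" by (auto simp: srel_auts_def)
    have "\<one>\<^bsub>aut_group (sgraph S)\<^esub> \<in> srel_auts S"
      using A.one_closed by (simp add: srel_auts_def) (simp add: one_aut_group)
    then show "srel_auts S \<noteq> {}" by blast
    fix g assume "g \<in> srel_auts S"
    note g = srel_autsD[OF this]
    let ?i = "inv\<^bsub>aut_group (sgraph S)\<^esub> g"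
    have i: "?i \<in> rgraph_auts (sgraph S)" using A.inv_closed[of g] g(1) by simp
    have "(fst ?i u, fst ?i w) \<in> srel S \<longleftrightarrow> (u, w) \<in> srel S"
      if "u \<in> verts (sgraph S)" "w \<in> verts (sgraph S)" for u w
      using g(2)[OF rgraph_autsD(4)[OF i that(1)] rgraph_autsD(4)[OF i that(2)]] that
      by (simp add: aut_group_inv_apply[OF sgraph_rgraph g(1)])
    then show "?i \<in> srel_auts S" using i by (simp add: srel_auts_def)
    fix h assume "h \<in> srel_auts S"
    note h = srel_autsD[OF this]
    show "g \<otimes>\<^bsub>aut_group (sgraph S)\<^esub> h \<in> srel_auts S"
      using A.m_closed[of g h] g(1,2) h(1,2) rgraph_autsD(4)[OF h(1)]
      by (simp add: srel_auts_def aut_group_mult_apply)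
  qed
qed

lemma assoc_tree_action_mult:
  assumes g: "g \<in> srel_auts S" and h: "h \<in> srel_auts S"
  shows "C \<in> verts (assoc_tree S) \<Longrightarrow>
      fst (assoc_tree_action S (g \<otimes>\<^bsub>aut_group (sgraph S)\<^esub> h)) C =
        fst (assoc_tree_action S g) (fst (assoc_tree_action S h) C)"
    and "D \<in> arcs (assoc_tree S) \<Longrightarrow>
      snd (assoc_tree_action S (g \<otimes>\<^bsub>aut_group (sgraph S)\<^esub> h)) D =
        snd (assoc_tree_action S g) (snd (assoc_tree_action S h) D)"
proof -
  note gh = srel_autsD(1)[OF g] srel_autsD(1)[OF h]
  note h_in = rgraph_autsD(4,5)[OF assoc_tree_action_in_rgraph_auts[OF h]]
  show "fst (assoc_tree_action S (g \<otimes>\<^bsub>aut_group (sgraph S)\<^esub> h)) C =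
      fst (assoc_tree_action S g) (fst (assoc_tree_action S h) C)"
    if C: "C \<in> verts (assoc_tree S)"
  proof -
    have "fst (g \<otimes>\<^bsub>aut_group (sgraph S)\<^esub> h) ` C = fst g ` fst h ` C"
      unfolding image_image using assoc_tree_class_subset(1)[OF C]
      by (intro image_cong refl) (auto simp: aut_group_mult_apply[OF gh])
    then show ?thesis using C h_in(1)[OF C] by (simp add: assoc_tree_action_def)
  qed
  show "snd (assoc_tree_action S (g \<otimes>\<^bsub>aut_group (sgraph S)\<^esub> h)) D =
      snd (assoc_tree_action S g) (snd (assoc_tree_action S h) D)"
    if D: "D \<in> arcs (assoc_tree S)"
  proof -
    have "snd (g \<otimes>\<^bsub>aut_group (sgraph S)\<^esub> h) ` D = snd g ` snd h ` D"
      unfolding image_image using assoc_tree_class_subset(2)[OF D]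
      by (intro image_cong refl) (auto simp: aut_group_mult_apply[OF gh])
    then show ?thesis using D h_in(2)[OF D] by (simp add: assoc_tree_action_def)
  qed
qed

lemma group_hom_assoc_tree_action:
  "group_hom (aut_group (sgraph S) \<lparr>carrier := srel_auts S\<rparr>) (aut_group (assoc_tree S))
     (assoc_tree_action S)"
proof (intro group_hom.intro group_hom_axioms.intro)
  show "group (aut_group (sgraph S) \<lparr>carrier := srel_auts S\<rparr>)"
    by (intro group.subgroup_imp_group group_aut_group sgraph_rgraph subgroup_srel_auts)
  show "group (aut_group (assoc_tree S))" by (rule group_aut_group[OF tree.rgraph_axioms])
  show "assoc_tree_action S \<in>
      hom (aut_group (sgraph S) \<lparr>carrier := srel_auts S\<rparr>) (aut_group (assoc_tree S))"
    using subgroup.m_closed[OF subgroup_srel_auts] srel_autsD(1)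
    by (intro hom_aut_groupI[where G = "sgraph S"] tree.rgraph_axioms)
      (auto simp: assoc_tree_action_in_rgraph_auts assoc_tree_action_mult)
qed

end

section \<open>The universal group as a Burger--Mozes group\<close>

text \<open>The orbit data enters in the form that the points \<open>x i\<close> are a transversal
  of the orbits of \<open>F\<close>.\<close>

locale burger_mozes_scaffolding =
  scaffolding "burger_mozes_gga X F I x" S
  for X :: "'x set" and F :: "('x \<Rightarrow> 'x) set" and I :: "'i set" and x :: "'i \<Rightarrow> 'x"
    and S :: "('s, 'e, unit, 'i, 'x, 'x) pre_scaffolding" +
  assumes perm_group: "subgroup F (BijGroup X)"
    and rep_in: "i \<in> I \<Longrightarrow> x i \<in> X"
    and rep_cover: "z \<in> X \<Longrightarrow> \<exists>i\<in>I. \<exists>h\<in>F. h (x i) = z"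
    and rep_unique: "\<lbrakk>i \<in> I; j \<in> I; h \<in> F; h (x i) = x j\<rbrakk> \<Longrightarrow> i = j"
begin

text \<open>\<open>the_elem\<close> is meaningful because arc classes are singletons here; the
  colour is then the only value of the scaffold map.\<close>

definition arc_colour :: "'e set \<Rightarrow> 'x" where
  "arc_colour D = labV S (head (sgraph S) (the_elem D))"

lemma gga_simps [simp]:
  "vset (burger_mozes_gga X F I x) v = X" "vgroup (burger_mozes_gga X F I x) v = F"
  "aset (burger_mozes_gga X F I x) i = {x i}" "arcs (base (burger_mozes_gga X F I x)) = I"
  "head (base (burger_mozes_gga X F I x)) i = ()"
  "arc_rev (base (burger_mozes_gga X F I x)) i = i"
  by (simp_all add: burger_mozes_gga_def)

lemma projA_in:
  assumes "D \<in> arcs (assoc_tree S)"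
  shows "projA S D \<in> I"
proof -
  have "projA S \<in> arcs (assoc_tree S) \<rightarrow> arcs (base (burger_mozes_gga X F I x))"
    using proj_hom by (simp only: rgraph_hom_def)
  from funcset_mem[OF this assms] show ?thesis by simp
qed

lemma projA_rev:
  assumes "D \<in> arcs (assoc_tree S)"
  shows "projA S (arc_rev (assoc_tree S) D) = projA S D"
proof -
  from proj_hom[unfolded rgraph_hom_def, THEN conjunct2, THEN conjunct2, rule_format, OF assms]
  have "arc_rev (base (burger_mozes_gga X F I x)) (projA S D)
      = projA S (arc_rev (assoc_tree S) D)" by blast
  then show ?thesis by simp
qed

text \<open>The labelling bijects each arc class with the set at its loop, and that set has one
  point.\<close>

lemma arel_class_singleton:
  assumes b: "b \<in> arcs (sgraph S)"
  shows "arel `` {b} = {b}"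
proof -
  have "bij_betw (labA S) (arel `` {b}) {x (projA S (arel `` {b}))}"
    using labA_bij[OF assoc_tree_arc(1)[OF b]] by simp
  then have "inj_on (labA S) (arel `` {b})"
    and img: "labA S ` (arel `` {b}) = {x (projA S (arel `` {b}))}"
    by (simp_all add: bij_betw_def)
  moreover have self: "b \<in> arel `` {b}" by (rule equiv_class_self[OF arel_equiv b])
  moreover have "labA S b' = labA S b" if "b' \<in> arel `` {b}" for b'
    using imageI[OF that, of "labA S"] imageI[OF self, of "labA S"] unfolding img by simp
  ultimately have "b' = b" if "b' \<in> arel `` {b}" for b'
    using that inj_onD by metis
  with self show ?thesis by blast
qed

lemma singleton_arc:
  assumes "b \<in> arcs (sgraph S)"
  shows "{b} \<in> arcs (assoc_tree S)"
    "tail (assoc_tree S) {b} = srel S `` {tail (sgraph S) b}"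
    "head (assoc_tree S) {b} = srel S `` {head (sgraph S) b}"
    "arc_rev (assoc_tree S) {b} = {arc_rev (sgraph S) b}"
  using assoc_tree_arc[OF assms] assms by (simp_all add: arel_class_singleton)

lemma arc_singletonE:
  assumes "D \<in> arcs (assoc_tree S)"
  obtains b where "b \<in> arcs (sgraph S)" "D = {b}"
proof -
  obtain b where b: "b \<in> arcs (sgraph S)" "D = arel `` {b}"
    using assms unfolding arcs_assoc_tree by (rule quotientE)
  then show thesis using that by (simp add: arel_class_singleton)
qed

lemma arc_colour_singleton [simp]: "arc_colour {b} = labV S (head (sgraph S) b)"
  by (simp add: arc_colour_def)

lemma scaffold_map_eq:
  assumes "D \<in> arcs (assoc_tree S)"
  shows "scaffold_map (burger_mozes_gga X F I x) S D (x (projA S D)) = arc_colour D"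
proof -
  obtain b where b: "D = {b}" using arc_singletonE[OF assms] .
  have "labA S ` D = {x (projA S D)}" using labA_bij[OF assms] by (simp add: bij_betw_def)
  then have "x (projA S D) = labA S b" by (simp add: b)
  then have "inv_into D (labA S) (x (projA S D)) = b"
    using inv_into_f_f[OF bij_betw_imp_inj_on[OF labA_bij[OF assms]], of b] by (simp add: b)
  then show ?thesis by (simp add: scaffold_map_def b)
qed

text \<open>The agent is the identity of a one-point set, so adhesion maps and twisted ones alike
  send \<open>x i\<close> to \<open>g (x i)\<close> with \<open>g\<close> in \<open>F\<close>; both
  alternatives for self-reverse arcs give the same conclusion.\<close>

lemma arc_colour_in_orbit:
  assumes D: "D \<in> arcs (assoc_tree S)"
  shows "\<exists>h\<in>F. h (x (projA S D)) = arc_colour D"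
proof -
  let ?G = "burger_mozes_gga X F I x"
  let ?i = "projA S D"
  have "scaffold_map ?G S D \<in> adhesion_maps ?G ?i \<union> twisted_adhesion_maps ?G ?i"
    using map_self_rev[OF D] by auto
  then obtain g where g: "g \<in> F" and
    "scaffold_map ?G S D = compose {x ?i} g (emb ?G ?i) \<or>
     scaffold_map ?G S D = compose {x ?i} g (compose {x ?i} (emb ?G ?i) (agent ?G ?i))"
    unfolding adhesion_maps_def twisted_adhesion_maps_def by auto
  then have "scaffold_map ?G S D (x ?i) = g (x ?i)"
    by (auto simp: compose_eq burger_mozes_gga_def BijGroup_def)
  then show ?thesis using g scaffold_map_eq[OF D] by auto
qed

lemma arc_colour_in:
  assumes "D \<in> arcs (assoc_tree S)"
  shows "arc_colour D \<in> X"
proof -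
  obtain h where h: "h \<in> F" "h (x (projA S D)) = arc_colour D"
    using arc_colour_in_orbit[OF assms] by blast
  from perm_closed[OF perm_group h(1) rep_in[OF projA_in[OF assms]]] h(2) show ?thesis by simp
qed

lemma rep_unique_orbit:
  assumes "i \<in> I" "j \<in> I" "g \<in> F" "h \<in> F" "g (x i) = h (x j)"
  shows "i = j"
proof -
  obtain h' where h': "h' \<in> F" "\<forall>y\<in>X. h' (h y) = y"
    using perm_inverse[OF perm_group assms(4)] by blast
  obtain k where k: "k \<in> F" "\<forall>y\<in>X. k y = h' (g y)"
    using perm_comp[OF perm_group h'(1) assms(3)] by blast
  have "k (x i) = x j" using h'(2) k(2) rep_in assms(1,2,5) by simp
  then show ?thesis using rep_unique[OF assms(1,2) k(1)] by simp
qed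

text \<open>An arc lies over the loop indexed by the orbit of its colour. Hence a map that changes
  colours by elements of \<open>F\<close> preserves the projection.\<close>

lemma projA_eqI:
  assumes D: "D \<in> arcs (assoc_tree S)" and D': "D' \<in> arcs (assoc_tree S)"
    and h: "h \<in> F" "arc_colour D' = h (arc_colour D)"
  shows "projA S D' = projA S D"
proof -
  obtain g where g: "g \<in> F" "g (x (projA S D)) = arc_colour D"
    using arc_colour_in_orbit[OF D] by blast
  obtain g' where g': "g' \<in> F" "g' (x (projA S D')) = arc_colour D'"
    using arc_colour_in_orbit[OF D'] by blast
  obtain k where k: "k \<in> F" "\<forall>y\<in>X. k y = h (g y)"
    using perm_comp[OF perm_group h(1) g(1)] by blast
  have "g' (x (projA S D')) = k (x (projA S D))"
    using g g' k(2) h(2) rep_in[OF projA_in[OF D]] by simp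
  then show ?thesis
    by (rule rep_unique_orbit[OF projA_in[OF D'] projA_in[OF D] g'(1) k(1)])
qed

text \<open>\<open>{z}\<close> is an adhesion set for the loop of the orbit of \<open>z\<close>, so
  the uniqueness axiom of scaffoldings yields one arc over that loop.\<close>

lemma unique_arc_of_colour:
  assumes C: "C \<in> verts (assoc_tree S)" and z: "z \<in> X"
  shows "\<exists>!D. D \<in> Star (assoc_tree S) C \<and> arc_colour D = z"
proof -
  let ?G = "burger_mozes_gga X F I x"
  obtain i h where i: "i \<in> I" and h: "h \<in> F" "h (x i) = z" using rep_cover[OF z] by blast
  have "compose {x i} h (emb ?G i) \<in> adhesion_maps ?G i"
    using h(1) by (auto simp: adhesion_maps_def)
  moreover have "compose {x i} h (emb ?G i) ` {x i} = {z}"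
    using h(2) by (simp add: compose_eq burger_mozes_gga_def)
  ultimately have "{z} \<in> adhesion_sets ?G i"
    unfolding adhesion_sets_def gga_simps by (intro image_eqI[where x = "compose {x i} h (emb ?G i)"]) simp_all
  then have "\<exists>!D. D \<in> arcs (assoc_tree S) \<and> head (assoc_tree S) D = C \<and> projA S D = i \<and>
      scaffold_map ?G S D ` aset ?G i = {z}"
    by (intro unique_arc C) (simp_all add: i)
  \<comment> \<open>The axiom counts arcs over the fixed loop \<open>i\<close>, the claim counts
    arcs in the whole star. They agree because an arc of colour \<open>z\<close> must lie over
    \<open>i\<close>.\<close>
  moreover have "(D \<in> arcs (assoc_tree S) \<and> head (assoc_tree S) D = C \<and> projA S D = i \<and>
      scaffold_map ?G S D ` aset ?G i = {z}) \<longleftrightarrow>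
      (D \<in> Star (assoc_tree S) C \<and> arc_colour D = z)" for D
  proof -
    have "projA S D = i" if D: "D \<in> arcs (assoc_tree S)" "arc_colour D = z"
    proof -
      obtain g where g: "g \<in> F" "g (x (projA S D)) = arc_colour D"
        using arc_colour_in_orbit[OF D(1)] by blast
      show ?thesis
        by (rule rep_unique_orbit[OF projA_in[OF D(1)] i g(1) h(1)]) (simp add: g(2) h(2) D(2))
    qed
    then show ?thesis using scaffold_map_eq[of D] by auto
  qed
  ultimately show ?thesis by simp
qed

lemma star_colouring_arc_colour: "star_colouring X (assoc_tree S) arc_colour"
  unfolding star_colouring_def
proof
  fix C assume C: "C \<in> verts (assoc_tree S)"
  show "bij_betw arc_colour (Star (assoc_tree S) C) X"
    unfolding bij_betw_def
  proof
    show "inj_on arc_colour (Star (assoc_tree S) C)"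
    proof (rule inj_onI)
      fix D D' assume D: "D \<in> Star (assoc_tree S) C" "D' \<in> Star (assoc_tree S) C"
        "arc_colour D = arc_colour D'"
      then have "arc_colour D' \<in> X" by (simp add: arc_colour_in)
      from unique_arc_of_colour[OF C this] D show "D = D'" by blast
    qed
    show "arc_colour ` Star (assoc_tree S) C = X"
    proof
      show "arc_colour ` Star (assoc_tree S) C \<subseteq> X" using arc_colour_in by auto
      show "X \<subseteq> arc_colour ` Star (assoc_tree S) C" using unique_arc_of_colour[OF C] by blast
    qed
  qed
qed

section \<open>Vertices of the scaffolding as termini of single arcs\<close>

lemma vertex_class: "s \<in> verts (sgraph S) \<Longrightarrow> srel S `` {s} \<in> verts (assoc_tree S)"
  by (simp add: verts_assoc_tree quotientI)

lemma self_in_class: "s \<in> verts (sgraph S) \<Longrightarrow> s \<in> srel S `` {s}"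
  by (rule equiv_class_self[OF srel_equiv])

lemma class_of_member:
  assumes "C \<in> verts (assoc_tree S)" "s \<in> C"
  shows "s \<in> verts (sgraph S)" "srel S `` {s} = C"
proof -
  show "s \<in> verts (sgraph S)" using assoc_tree_class_subset(1)[OF assms(1)] assms(2) by blast
  obtain u where u: "C = srel S `` {u}" using assms(1) unfolding verts_assoc_tree by (rule quotientE)
  then have "(u, s) \<in> srel S" using assms(2) by simp
  from srel_class_eq[OF this] u show "srel S `` {s} = C" by simp
qed

text \<open>
  This is why an automorphism of the scaffolding is determined by its action on the arcs, which are
  the arcs of the associated tree.
\<close>

lemma bij_betw_head: "bij_betw (head (sgraph S)) (arcs (sgraph S)) (verts (sgraph S))"
  unfolding bij_betw_def
proof
  show "inj_on (head (sgraph S)) (arcs (sgraph S))"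
  proof (rule inj_onI)
    fix b b' assume b: "b \<in> arcs (sgraph S)" "b' \<in> arcs (sgraph S)"
      "head (sgraph S) b = head (sgraph S) b'"
    let ?C = "srel S `` {head (sgraph S) b'}"
    have "inj_on arc_colour (Star (assoc_tree S) ?C)"
      using star_colouringD[OF star_colouring_arc_colour vertex_class] b
      by (simp add: bij_betw_def)
    moreover have "{b} \<in> Star (assoc_tree S) ?C" "{b'} \<in> Star (assoc_tree S) ?C"
      using b by (simp_all add: singleton_arc)
    moreover have "arc_colour {b} = arc_colour {b'}" using b(3) by simp
    ultimately have "{b} = {b'}" by (metis inj_onD)
    then show "b = b'" by simp
  qed
  show "head (sgraph S) ` arcs (sgraph S) = verts (sgraph S)"
  proof
    show "head (sgraph S) ` arcs (sgraph S) \<subseteq> verts (sgraph S)" by auto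
    show "verts (sgraph S) \<subseteq> head (sgraph S) ` arcs (sgraph S)"
    proof
      fix s assume s: "s \<in> verts (sgraph S)"
      let ?C = "srel S `` {s}"
      have lab: "bij_betw (labV S) ?C X" using labV_bij[OF vertex_class[OF s]] by simp
      then have "labV S s \<in> X" using self_in_class[OF s] by (auto dest: bij_betwE)
      \<comment> \<open>The arc at the class of \<open>s\<close> whose colour is the label of
        \<open>s\<close> ends inside that class at a vertex with the same label, hence at
        \<open>s\<close>.\<close>
      then obtain D where D: "D \<in> Star (assoc_tree S) ?C" "arc_colour D = labV S s"
        using unique_arc_of_colour[OF vertex_class[OF s]] by blast
      from D(1) have "D \<in> arcs (assoc_tree S)" by simp
      then obtain b where b: "b \<in> arcs (sgraph S)" "D = {b}" by (rule arc_singletonE)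
      have "srel S `` {head (sgraph S) b} = ?C" using D(1) b by (simp add: singleton_arc)
      then have "head (sgraph S) b \<in> ?C" using self_in_class[of "head (sgraph S) b"] b(1) by simp
      moreover have "labV S (head (sgraph S) b) = labV S s" using D(2) b(2) by simp
      ultimately have "head (sgraph S) b = s"
        using inj_onD[OF bij_betw_imp_inj_on[OF lab] _ _ self_in_class[OF s]] by blast
      then show "s \<in> head (sgraph S) ` arcs (sgraph S)" using b(1) by blast
    qed
  qed
qed

lemma snd_assoc_tree_action_singleton:
  "b \<in> arcs (sgraph S) \<Longrightarrow> snd (assoc_tree_action S g) {b} = {snd g b}"
  by (simp add: assoc_tree_action_def singleton_arc)

text \<open>Taking termini matches the star of \<open>C\<close> with the members of \<open>C\<close>
  and colours with labels, so the same \<open>h\<close> describes the action on both.\<close>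

lemma local_perm_mem_iff:
  assumes g: "g \<in> srel_auts S" and C: "C \<in> verts (assoc_tree S)"
  shows "local_perm (burger_mozes_gga X F I x) S g C \<in> F \<longleftrightarrow>
    (\<exists>h\<in>F. \<forall>D\<in>Star (assoc_tree S) C.
       arc_colour (snd (assoc_tree_action S g) D) = h (arc_colour D))"
proof -
  have lab: "bij_betw (labV S) C X" using labV_bij[OF C] by simp
  have star: "\<exists>b. D = {b} \<and> b \<in> arcs (sgraph S) \<and> head (sgraph S) b \<in> C"
    if D: "D \<in> Star (assoc_tree S) C" for D
  proof -
    from D have "D \<in> arcs (assoc_tree S)" by simp
    then obtain b where b: "b \<in> arcs (sgraph S)" "D = {b}" by (rule arc_singletonE)
    then have "srel S `` {head (sgraph S) b} = C" using D by (simp add: singleton_arc)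
    then show ?thesis using self_in_class[of "head (sgraph S) b"] b by auto
  qed
  have verts: "\<exists>b\<in>arcs (sgraph S). head (sgraph S) b = s \<and> {b} \<in> Star (assoc_tree S) C"
    if s: "s \<in> C" for s
  proof -
    have "s \<in> head (sgraph S) ` arcs (sgraph S)"
      using class_of_member(1)[OF C s] bij_betw_head by (simp add: bij_betw_def)
    then obtain b where "b \<in> arcs (sgraph S)" "head (sgraph S) b = s" by blast
    then show ?thesis using class_of_member(2)[OF C s] by (auto simp: singleton_arc)
  qed
  have col: "arc_colour (snd (assoc_tree_action S g) {b}) = labV S (fst g (head (sgraph S) b))"
    if "b \<in> arcs (sgraph S)" for b
    using that by (simp add: snd_assoc_tree_action_singleton rgraph_autsD(7)[OF srel_autsD(1)[OF g]])
  have "local_perm (burger_mozes_gga X F I x) S g C \<in> F \<longleftrightarrow>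
      (\<exists>h\<in>F. \<forall>s\<in>C. labV S (fst g s) = h (labV S s))"
    unfolding local_perm_def gga_simps by (rule restrict_inv_into_mem_iff[OF perm_group lab])
  moreover have "(\<forall>s\<in>C. labV S (fst g s) = h (labV S s)) \<longleftrightarrow>
      (\<forall>D\<in>Star (assoc_tree S) C.
         arc_colour (snd (assoc_tree_action S g) D) = h (arc_colour D))" for h
  proof
    assume L: "\<forall>s\<in>C. labV S (fst g s) = h (labV S s)"
    show "\<forall>D\<in>Star (assoc_tree S) C.
        arc_colour (snd (assoc_tree_action S g) D) = h (arc_colour D)"
    proof
      fix D assume "D \<in> Star (assoc_tree S) C"
      from star[OF this] obtain b where "D = {b}" "b \<in> arcs (sgraph S)" "head (sgraph S) b \<in> C"
        by blast
      then show "arc_colour (snd (assoc_tree_action S g) D) = h (arc_colour D)"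
        using L by (simp add: col)
    qed
  next
    assume R: "\<forall>D\<in>Star (assoc_tree S) C.
        arc_colour (snd (assoc_tree_action S g) D) = h (arc_colour D)"
    show "\<forall>s\<in>C. labV S (fst g s) = h (labV S s)"
    proof
      fix s assume "s \<in> C"
      from verts[OF this] obtain b where b: "b \<in> arcs (sgraph S)" "head (sgraph S) b = s"
        "{b} \<in> Star (assoc_tree S) C" by blast
      from R[rule_format, OF b(3)] show "labV S (fst g s) = h (labV S s)"
        using col[OF b(1)] b(2) by simp
    qed
  qed
  ultimately show ?thesis by simp
qed

section \<open>The universal group as a group of tree automorphisms\<close>

abbreviation "BM \<equiv> burger_mozes_group X F (assoc_tree S) arc_colour"
abbreviation "UG \<equiv> universal_group (burger_mozes_gga X F I x) S"

lemma mem_universal_group: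
  "g \<in> carrier UG \<longleftrightarrow> g \<in> srel_auts S \<and> assoc_tree_action S g \<in> carrier BM"
proof -
  \<comment> \<open>Preservation of arc projections has to be derived from the local condition:
    colours move within their \<open>F\<close>-orbit, and the orbit of the colour determines the
    loop. For vertices it is automatic, since the base has a single vertex.\<close>
  have "(\<forall>D\<in>arcs (assoc_tree S). projA S (snd g ` D) = projA S D)"
    if g: "g \<in> srel_auts S" and L: "\<forall>C\<in>verts (assoc_tree S).
      local_perm (burger_mozes_gga X F I x) S g C \<in> F"
  proof
    fix D assume D: "D \<in> arcs (assoc_tree S)"
    let ?C = "head (assoc_tree S) D"
    have C: "?C \<in> verts (assoc_tree S)" using D by simp
    obtain h where h: "h \<in> F" "\<forall>D\<in>Star (assoc_tree S) ?C.
       arc_colour (snd (assoc_tree_action S g) D) = h (arc_colour D)"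
      using L[rule_format, OF C] unfolding local_perm_mem_iff[OF g C] by blast
    have "snd (assoc_tree_action S g) D \<in> arcs (assoc_tree S)"
      by (rule rgraph_autsD(5)[OF assoc_tree_action_in_rgraph_auts[OF g] D])
    moreover have "snd (assoc_tree_action S g) D = snd g ` D"
      using D by (simp add: assoc_tree_action_def)
    moreover have "arc_colour (snd (assoc_tree_action S g) D) = h (arc_colour D)"
      using h(2) D by simp
    ultimately show "projA S (snd g ` D) = projA S D"
      using projA_eqI[OF D _ h(1)] by simp
  qed
  then have "g \<in> carrier UG \<longleftrightarrow> g \<in> srel_auts S \<and>
      (\<forall>C\<in>verts (assoc_tree S). local_perm (burger_mozes_gga X F I x) S g C \<in> F)"
    unfolding universal_group_def srel_auts_def by auto
  then show ?thesis
    using local_perm_mem_iff[of g] assoc_tree_action_in_rgraph_auts[of g]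
    unfolding mem_burger_mozes_group[OF perm_group star_colouring_arc_colour] by blast
qed

lemma mult_universal_group [simp]: "mult UG = mult (aut_group (sgraph S))"
  by (simp add: universal_group_def)

lemma subgroup_BM: "subgroup (carrier BM) (aut_group (assoc_tree S))"
  by (rule subgroup_burger_mozes_group[OF tree.rgraph_axioms perm_group star_colouring_arc_colour])

lemma group_universal_group: "group UG"
proof -
  let ?A = "aut_group (sgraph S) \<lparr>carrier := srel_auts S\<rparr>"
  interpret act: group_hom ?A "aut_group (assoc_tree S)" "assoc_tree_action S"
    by (rule group_hom_assoc_tree_action)
  \<comment> \<open>The universal group is the preimage of \<open>BM\<close> under the action, hence
    a subgroup of the relation-preserving automorphisms.\<close>
  have "subgroup {g \<in> carrier ?A. assoc_tree_action S g \<in> carrier BM} ?A"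
    by (rule act.subgroup_vimage[OF subgroup_BM])
  moreover have "{g \<in> carrier ?A. assoc_tree_action S g \<in> carrier BM} = carrier UG"
    using mem_universal_group by auto
  ultimately have "group (?A \<lparr>carrier := carrier UG\<rparr>)"
    by (simp only: act.G.subgroup_imp_group)
  then show ?thesis by (simp add: universal_group_def)
qed

lemma assoc_tree_action_hom:
  "assoc_tree_action S \<in> hom UG (aut_group (assoc_tree S))"
proof (rule homI)
  interpret act: group_hom "aut_group (sgraph S) \<lparr>carrier := srel_auts S\<rparr>"
    "aut_group (assoc_tree S)" "assoc_tree_action S"
    by (rule group_hom_assoc_tree_action)
  show "assoc_tree_action S g \<in> carrier (aut_group (assoc_tree S))" if "g \<in> carrier UG" for g
    using that assoc_tree_action_in_rgraph_auts unfolding mem_universal_group by simp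
  show "assoc_tree_action S (g \<otimes>\<^bsub>UG\<^esub> h) =
      assoc_tree_action S g \<otimes>\<^bsub>aut_group (assoc_tree S)\<^esub> assoc_tree_action S h"
    if "g \<in> carrier UG" "h \<in> carrier UG" for g h
    using that act.hom_mult[of g h] unfolding mem_universal_group by simp
qed

lemma assoc_tree_action_inj: "inj_on (assoc_tree_action S) (srel_auts S)"
proof (rule inj_onI)
  fix g g' assume g: "g \<in> srel_auts S" "g' \<in> srel_auts S"
    and eq: "assoc_tree_action S g = assoc_tree_action S g'"
  note gD = srel_autsD(1)[OF g(1)] srel_autsD(1)[OF g(2)]
  have arcs: "snd g b = snd g' b" if "b \<in> arcs (sgraph S)" for b
    using snd_assoc_tree_action_singleton[OF that, of g] snd_assoc_tree_action_singleton[OF that, of g']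
    by (simp add: eq)
  show "g = g'"
  proof (rule rgraph_auts_eqI[OF gD])
    fix s assume "s \<in> verts (sgraph S)"
    then obtain b where b: "b \<in> arcs (sgraph S)" "s = head (sgraph S) b"
      using bij_betw_imp_surj_on[OF bij_betw_head] by blast
    show "fst g s = fst g' s"
      using rgraph_autsD(7)[OF gD(1) b(1)] rgraph_autsD(7)[OF gD(2) b(1)] arcs[OF b(1)] b(2) by simp
  qed (rule arcs)
qed

text \<open>Arcs of the tree are singletons, so \<gamma> already permutes the arcs of the
  scaffolding; the action on vertices is then forced, each vertex being the terminus of one
  arc.\<close>

lemma assoc_tree_action_surj:
  assumes \<gamma>: "\<gamma> \<in> rgraph_auts (assoc_tree S)"
  obtains g where "g \<in> srel_auts S" "assoc_tree_action S g = \<gamma>"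
proof -
  note \<gamma>D = rgraph_autsD[OF \<gamma>]
  let ?V = "verts (sgraph S)" and ?A = "arcs (sgraph S)"
  have sing: "bij_betw (\<lambda>b. {b}) ?A (arcs (assoc_tree S))"
    by (rule bij_betwI[where g = the_elem]) (auto simp: singleton_arc elim!: arc_singletonE)
  define gA where "gA = (\<lambda>b\<in>?A. the_elem (snd \<gamma> {b}))"
  define gV where "gV = (\<lambda>s\<in>?V. head (sgraph S) (gA (inv_into ?A (head (sgraph S)) s)))"
  have \<gamma>_sing: "snd \<gamma> {b} = {gA b}" and gA_in: "gA b \<in> ?A" if b: "b \<in> ?A" for b
  proof -
    have "snd \<gamma> {b} \<in> arcs (assoc_tree S)" using \<gamma>D(5) singleton_arc(1)[OF b] by simp
    then obtain b' where "b' \<in> ?A" "snd \<gamma> {b} = {b'}" by (rule arc_singletonE)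
    then show "snd \<gamma> {b} = {gA b}" "gA b \<in> ?A" using b by (simp_all add: gA_def)
  qed
  have gV_head: "gV (head (sgraph S) b) = head (sgraph S) (gA b)" if "b \<in> ?A" for b
    using that bij_betw_inv_into_left[OF bij_betw_head that] by (simp add: gV_def)
  have gA_rev: "arc_rev (sgraph S) (gA b) = gA (arc_rev (sgraph S) b)" if b: "b \<in> ?A" for b
  proof -
    have "arc_rev (assoc_tree S) (snd \<gamma> {b}) = snd \<gamma> (arc_rev (assoc_tree S) {b})"
      using \<gamma>D(8) b by (simp add: singleton_arc)
    then show ?thesis using b by (simp add: \<gamma>_sing gA_in singleton_arc)
  qed
  \<comment> \<open>\<open>gV\<close> is defined through termini, so origins are treated by passing
    to the reverse arc.\<close>
  have gV_tail: "tail (sgraph S) (gA b) = gV (tail (sgraph S) b)" if b: "b \<in> ?A" for b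
    using gV_head[of "arc_rev (sgraph S) b"] gA_rev[OF b, symmetric] b gA_in[OF b] by simp
  have class_head: "fst \<gamma> (srel S `` {head (sgraph S) b}) = srel S `` {gV (head (sgraph S) b)}"
    if b: "b \<in> ?A" for b
    using \<gamma>D(7)[of "{b}"] b gA_in[OF b] by (simp add: singleton_arc \<gamma>_sing gV_head)
  have headE: "\<exists>b\<in>?A. s = head (sgraph S) b" if "s \<in> ?V" for s
    using that bij_betw_imp_surj_on[OF bij_betw_head] by blast
  have class_eq: "fst \<gamma> (srel S `` {s}) = srel S `` {gV s}" if "s \<in> ?V" for s
    using headE[OF that] class_head by blast
  have "bij_betw (snd \<gamma>) (arcs (assoc_tree S)) (arcs (assoc_tree S))"
    using \<gamma>D(2) by (simp add: Bij_def)
  from bij_betw_trans[OF bij_betw_trans[OF sing this] bij_betw_inv_into[OF sing]]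
  have "bij_betw (inv_into ?A (\<lambda>b. {b}) \<circ> (snd \<gamma> \<circ> (\<lambda>b. {b}))) ?A ?A" .
  moreover have "(inv_into ?A (\<lambda>b. {b}) \<circ> (snd \<gamma> \<circ> (\<lambda>b. {b}))) b = gA b" if "b \<in> ?A" for b
    using that bij_betw_inv_into_left[OF sing gA_in[OF that]] by (simp add: \<gamma>_sing)
  ultimately have gA_bij: "bij_betw gA ?A ?A" using bij_betw_cong by blast
  have "bij_betw (head (sgraph S) \<circ> (gA \<circ> inv_into ?A (head (sgraph S)))) ?V ?V"
    by (intro bij_betw_trans[OF bij_betw_trans[OF bij_betw_inv_into[OF bij_betw_head] gA_bij]]
        bij_betw_head)
  moreover have "(head (sgraph S) \<circ> (gA \<circ> inv_into ?A (head (sgraph S)))) s = gV s" if "s \<in> ?V" for s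
    using that by (simp add: gV_def)
  ultimately have gV_bij: "bij_betw gV ?V ?V" using bij_betw_cong by blast
  have gV_in: "gV s \<in> ?V" if "s \<in> ?V" for s using bij_betwE[OF gV_bij] that by blast
  have "gV \<in> extensional ?V" "gA \<in> extensional ?A" by (simp_all add: gV_def gA_def)
  then have g: "(gV, gA) \<in> rgraph_auts (sgraph S)"
    using gV_bij gA_bij gV_in gA_in
    by (auto simp: rgraph_auts_def rgraph_hom_def Bij_def gV_head gV_tail gA_rev)
  \<comment> \<open>\<gamma> sends the class of \<open>s\<close> to the class of \<open>gV s\<close>
    and is injective on classes, so the relation is both preserved and reflected.\<close>
  have pres: "(gV u, gV w) \<in> srel S \<longleftrightarrow> (u, w) \<in> srel S" if uw: "u \<in> ?V" "w \<in> ?V" for u w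
  proof -
    have inj: "inj_on (fst \<gamma>) (verts (assoc_tree S))"
      using \<gamma>D(1) by (auto simp: Bij_def bij_betw_def)
    have "(gV u, gV w) \<in> srel S \<longleftrightarrow> srel S `` {gV u} = srel S `` {gV w}"
      by (rule eq_equiv_class_iff[OF srel_equiv gV_in[OF uw(1)] gV_in[OF uw(2)], symmetric])
    also have "\<dots> \<longleftrightarrow> fst \<gamma> (srel S `` {u}) = fst \<gamma> (srel S `` {w})" by (simp add: class_eq uw)
    also have "\<dots> \<longleftrightarrow> srel S `` {u} = srel S `` {w}"
      by (rule inj_on_eq_iff[OF inj vertex_class[OF uw(1)] vertex_class[OF uw(2)]])
    also have "\<dots> \<longleftrightarrow> (u, w) \<in> srel S" by (rule eq_equiv_class_iff[OF srel_equiv uw])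
    finally show ?thesis .
  qed
  have g_srel: "(gV, gA) \<in> srel_auts S" using g pres by (simp add: srel_auts_def)
  have "assoc_tree_action S (gV, gA) = \<gamma>"
  proof (rule rgraph_auts_eqI[OF assoc_tree_action_in_rgraph_auts[OF g_srel] \<gamma>])
    fix C assume C: "C \<in> verts (assoc_tree S)"
    then obtain s where s: "s \<in> ?V" "C = srel S `` {s}"
      unfolding verts_assoc_tree by (rule quotientE)
    show "fst (assoc_tree_action S (gV, gA)) C = fst \<gamma> C"
      using C s srel_auts_image(1)[OF g_srel s(1)] by (simp add: assoc_tree_action_def class_eq)
  next
    fix D assume D: "D \<in> arcs (assoc_tree S)"
    then obtain b where b: "b \<in> ?A" "D = {b}" by (rule arc_singletonE)
    then show "snd (assoc_tree_action S (gV, gA)) D = snd \<gamma> D"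
      by (simp add: snd_assoc_tree_action_singleton \<gamma>_sing)
  qed
  then show thesis by (rule that[OF g_srel])
qed

lemma assoc_tree_action_iso: "assoc_tree_action S \<in> iso UG BM"
proof -
  have "assoc_tree_action S ` carrier UG = carrier BM"
  proof
    show "assoc_tree_action S ` carrier UG \<subseteq> carrier BM"
      using mem_universal_group by blast
    show "carrier BM \<subseteq> assoc_tree_action S ` carrier UG"
    proof
      fix \<gamma> assume \<gamma>: "\<gamma> \<in> carrier BM"
      obtain g where "g \<in> srel_auts S" "assoc_tree_action S g = \<gamma>"
        using assoc_tree_action_surj[OF burger_mozes_group_auts[OF \<gamma>]] .
      then show "\<gamma> \<in> assoc_tree_action S ` carrier UG"
        using \<gamma> mem_universal_group[of g] by blast
    qed
  qed
  moreover have "inj_on (assoc_tree_action S) (carrier UG)"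
    using mem_universal_group by (intro inj_on_subset[OF assoc_tree_action_inj]) blast
  moreover have "assoc_tree_action S \<in> hom UG BM"
    using assoc_tree_action_hom mem_universal_group by (auto simp: hom_def)
  ultimately show ?thesis by (simp add: iso_def bij_betw_def)
qed

theorem universal_group_action_isomorphic:
  assumes T: "rtree T" and c: "legal_colouring X T c"
  shows "isomorphic_tree_actions UG (assoc_tree S) (assoc_tree_action S)
    (burger_mozes_group X F T c) T (\<lambda>g. g)"
proof -
  interpret T: rtree T by fact
  let ?d = arc_colour
  have "\<forall>D\<in>arcs (assoc_tree S). \<exists>h. h \<in> F \<and> h (x (projA S D)) = ?d D"
    using arc_colour_in_orbit by blast
  from bchoice[OF this] obtain k where k: "\<forall>D\<in>arcs (assoc_tree S). k D \<in> F \<and> k D (x (projA S D)) = ?d D" ..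
  \<comment> \<open>The representative \<open>x (projA S D)\<close> serves as \<open>r\<close>: it
    depends only on the loop, which an arc shares with its reverse.\<close>
  obtain f where f: "f \<in> verts (assoc_tree S) \<rightarrow> F"
    "legal_colouring X (assoc_tree S) (\<lambda>D. f (head (assoc_tree S) D) (?d D))"
    by (rule legal_colouring_of_orbit_colouring[OF assoc_tree_rtree perm_group
          star_colouring_arc_colour, where k = k and r = "\<lambda>D. x (projA S D)"])
      (use k in \<open>simp_all add: rep_in projA_in projA_rev\<close>)
  \<comment> \<open>This isomorphism preserves the corrected colouring. Relative to the original one
    it recolours the star at each vertex \<open>C\<close> by \<open>f C\<close>, the form that
    conjugation requires.\<close>
  obtain \<Phi> \<Psi> where inv: "inverse_homs (assoc_tree S) T \<Phi> \<Psi>"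
    and col: "\<forall>D\<in>arcs (assoc_tree S). c (snd \<Phi> D) = f (head (assoc_tree S) D) (?d D)"
    using legal_colouring_unique[OF assoc_tree_rtree f(2) T c] by blast
  have conj: "conj_auts T \<Phi> \<Psi> \<in> iso BM (burger_mozes_group X F T c)"
    by (rule conj_auts_iso[OF tree.rgraph_axioms T.rgraph_axioms perm_group inv
          star_colouring_arc_colour legal_colouringD(1)[OF c], where f = f])
      (use f(1) col in auto)
  have iso: "conj_auts T \<Phi> \<Psi> \<circ> assoc_tree_action S \<in> iso UG (burger_mozes_group X F T c)"
    by (rule iso_set_trans[OF assoc_tree_action_iso conj])
  note \<Phi> = inverse_homsD[OF inv]
  interpret BT: subgroup "carrier (burger_mozes_group X F T c)" "aut_group T"
    by (rule subgroup_burger_mozes_group[OF T.rgraph_axioms perm_group legal_colouringD(1)[OF c]])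
  have "group (aut_group T \<lparr>carrier := carrier (burger_mozes_group X F T c)\<rparr>)"
    by (rule BT.subgroup_is_group[OF group_aut_group[OF T.rgraph_axioms]])
  then have "group (burger_mozes_group X F T c)" by (simp add: burger_mozes_group_def)
  then have hom': "group_hom (burger_mozes_group X F T c) (aut_group T) (\<lambda>g. g)"
    using group_aut_group[OF T.rgraph_axioms] BT.subset
    by (auto simp: group_hom_def group_hom_axioms_def hom_def)
  have hom: "group_hom UG (aut_group (assoc_tree S)) (assoc_tree_action S)"
    by (intro group_hom.intro group_hom_axioms.intro group_universal_group
        group_aut_group[OF tree.rgraph_axioms] assoc_tree_action_hom)
  show ?thesis
    unfolding isomorphic_tree_actions_def
  proof (intro conjI hom hom' exI ballI)
    show "conj_auts T \<Phi> \<Psi> \<circ> assoc_tree_action S \<in> iso UG (burger_mozes_group X F T c)"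
      by (rule iso)
    show "rgraph_iso (assoc_tree S) T (fst \<Phi>) (snd \<Phi>)" by (rule inverse_homs_iso[OF inv])
  qed (simp_all add: conj_auts_def \<Phi>)
qed

end

section \<open>Orbits and their representatives\<close>

lemma orbit_of_image:
  assumes F: "subgroup F (BijGroup X)" and g: "g \<in> F" and y: "y \<in> X"
  shows "{h (g y) |h. h \<in> F} = {h y |h. h \<in> F}"
proof -
  obtain g' where g': "g' \<in> F" "\<forall>y\<in>X. g' (g y) = y" using perm_inverse[OF F g] by blast
  have "\<exists>k\<in>F. h (g y) = k y" if h: "h \<in> F" for h
  proof -
    obtain k where "k \<in> F" "\<forall>y\<in>X. k y = h (g y)" using perm_comp[OF F h g] by blast
    then show ?thesis using y by (intro bexI[of _ k]) simp_all
  qed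
  moreover have "\<exists>k\<in>F. h y = k (g y)" if h: "h \<in> F" for h
  proof -
    obtain k where "k \<in> F" "\<forall>y\<in>X. k y = h (g' y)" using perm_comp[OF F h g'(1)] by blast
    then show ?thesis using y g'(2) perm_closed[OF F g y] by (intro bexI[of _ k]) simp_all
  qed
  ultimately show ?thesis by blast
qed

lemma orbit_representatives:
  assumes F: "subgroup F (BijGroup X)"
    and Orb: "bij_betw Orb I (orbits ((BijGroup X) \<lparr>carrier := F\<rparr>) X (\<lambda>g. g))"
    and x: "\<And>i. i \<in> I \<Longrightarrow> x i \<in> Orb i"
  shows "i \<in> I \<Longrightarrow> x i \<in> X" and "z \<in> X \<Longrightarrow> \<exists>i\<in>I. \<exists>h\<in>F. h (x i) = z"
    and "\<lbrakk>i \<in> I; j \<in> I; h \<in> F; h (x i) = x j\<rbrakk> \<Longrightarrow> i = j"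
proof -
  have Orb_image: "Orb ` I = {{g y |g. g \<in> F} |y. y \<in> X}"
    using Orb by (simp add: bij_betw_def orbits_def orbit_def)
  have Orb_eq: "\<exists>y g. y \<in> X \<and> g \<in> F \<and> Orb i = {g y |g. g \<in> F} \<and> x i = g y" if i: "i \<in> I" for i
  proof -
    obtain y where y: "y \<in> X" "Orb i = {g y |g. g \<in> F}"
      using imageI[OF i, of Orb] unfolding Orb_image by blast
    then obtain g where "g \<in> F" "x i = g y" using x[OF i] by blast
    with y show ?thesis by blast
  qed
  show x_in: "x i \<in> X" if "i \<in> I" for i
    using Orb_eq[OF that] perm_closed[OF F] by auto
  \<comment> \<open>\<open>Orb i\<close> is given as the orbit of some point \<open>y\<close>; since
    \<open>x i\<close> lies in it, the orbit can be based at \<open>x i\<close> instead.\<close>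
  have orbit_eq: "Orb i = {h (x i) |h. h \<in> F}" if i: "i \<in> I" for i
  proof -
    obtain y g where y: "y \<in> X" "g \<in> F" "Orb i = {g y |g. g \<in> F}" "x i = g y"
      using Orb_eq[OF i] by blast
    then show ?thesis using orbit_of_image[OF F y(2,1)] by simp
  qed
  show "\<exists>i\<in>I. \<exists>h\<in>F. h (x i) = z" if z: "z \<in> X"
  proof -
    have "{g z |g. g \<in> F} \<in> Orb ` I" unfolding Orb_image using z by blast
    then obtain i where i: "i \<in> I" "Orb i = {g z |g. g \<in> F}" by blast
    have "z = \<one>\<^bsub>BijGroup X\<^esub> z" using z by (simp add: BijGroup_def)
    then have "z \<in> Orb i" using subgroup.one_closed[OF F] unfolding i(2) by blast
    then show ?thesis using i(1) unfolding orbit_eq[OF i(1)] by blast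
  qed
  show "i = j" if ij: "i \<in> I" "j \<in> I" and h: "h \<in> F" "h (x i) = x j"
  proof -
    have "Orb i = Orb j"
      using orbit_of_image[OF F h(1) x_in[OF ij(1)]] h(2) ij by (simp add: orbit_eq)
    then show ?thesis using Orb ij by (auto simp: bij_betw_def dest: inj_onD)
  qed
qed

theorem proposition9p2:
  fixes X :: "'x set" and F :: "('x \<Rightarrow> 'x) set"
    and I :: "'i set" and Orb :: "'i \<Rightarrow> 'x set" and x :: "'i \<Rightarrow> 'x"
    and S :: "('s, 'e, unit, 'i, 'x, 'x) pre_scaffolding"
    and T :: "('v, 'a) pre_rgraph" and c :: "'a \<Rightarrow> 'x"
  assumes "X \<noteq> {}"
    and "subgroup F (BijGroup X)"
    and "bij_betw Orb I (orbits ((BijGroup X) \<lparr>carrier := F\<rparr>) X (\<lambda>g. g))"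
    and "\<And>i. i \<in> I \<Longrightarrow> x i \<in> Orb i"
    and "scaffolding (burger_mozes_gga X F I x) S"
    and "regular_tree X T"
    and "legal_colouring X T c"
  shows "isomorphic_tree_actions
           (universal_group (burger_mozes_gga X F I x) S) (assoc_tree S) (assoc_tree_action S)
           (burger_mozes_group X F T c) T (\<lambda>g. g)"
proof -
  interpret burger_mozes_scaffolding X F I x S
    by (intro burger_mozes_scaffolding.intro burger_mozes_scaffolding_axioms.intro assms(2,5)
        orbit_representatives[OF assms(2-4)])
  show ?thesis
    using assms(6,7) by (intro universal_group_action_isomorphic) (simp_all add: regular_tree_def)
qed

end
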